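(* Let $\mathcal{X},\mathcal{X}'$ be a partially ordered norming dual pair with Banach norms denoted $\pi$, and let $\mathcal{T}(t)$ be a positive $\pi$-compatible $C_b$ semigroup on $\mathcal{X}$ with generator $\mathcal{A}$. Let $\mathcal{F}\subset\mathcal{X}'^+$ be an $L^1$ $\pi$-stability subset for a class of semigroups containing $\mathcal{T}(t)$, and let $z\in\mathcal{X}^+$ be an $L^1$ $\pi$-detector relative to $\mathcal{F}$. Assume additionally that $\mathcal{X}'^+$ is generating. Then the following conditions are equivalent: (i) $\mathcal{A}x=-z$ has a positive solution $x\in\mathcal{D}_{\mathcal{A}}\cap\mathcal{X}^+$; (ii$'$) $\mathcal{T}(t)$ is $L^1$ $\pi$-stable, i.e. $\int_0^\infty\pi(\mathcal{T}'(t)\varphi)\,dt<\infty$ for all $\varphi\in\mathcal{X}'^+$; (ii) $\mathcal{T}(t)$ is exponentially $\pi$-stable, i.e. there are $M,\varepsilon>0$ such that $\pi(\mathcal{T}(t)x)\le Me^{-\varepsilon t}\pi(x)$ for all $x\in\mathcal{X}$, $t\ge0$; (iii) $\mathcal{A}$ has a $\pi$-bounded inverse defined on all of $\mathcal{X}$ and $-\mathcal{A}^{-1}\ge0$.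
   Context: Setting: $\mathcal{X}$ is a real locally convex space with dual $\mathcal{X}'$ and pairing $\langle\cdot,\cdot\rangle$, having compactness of convex closures (closures of convex hulls of metrizable compact subsets are compact). It is partially ordered by a closed proper cone $\mathcal{X}^+$; the dual cone is $\mathcal{X}'^+:=\{\varphi\in\mathcal{X}'\mid\langle\varphi,x\rangle\ge0\ \forall x\in\mathcal{X}^+\}$, and it is generating if $\mathcal{X}'=\mathcal{X}'^+-\mathcal{X}'^+$. A (linear) operator is positive ($\ge0$) if it maps $\mathcal{X}^+$ into itself; a semigroup is positive if all its operators are. $\mathcal{X},\mathcal{X}'$ form a norming dual pair: the vector space $\mathcal{X}$ also carries a Banach norm $\pi$, $\mathcal{X}'$ is a closed subspace of the Banach dual $\mathcal{X}^*$ of $(\mathcal{X},\pi)$, with the dual norm also denoted $\pi$, and $\pi(x)=\sup\{|\langle\varphi,x\rangle|:\varphi\in\mathcal{X}',\ \pi(\varphi)\le1\}$ for all $x\in\mathcal{X}$. A family of continuous linear operators $\mathcal{T}(t):\mathcal{X}\to\mathcal{X}$, $t\ge0$ (continuous for the locally convex topology), is a $C_b$ semigroup if: (1) $\mathcal{T}(0)=I$, $\mathcal{T}(t+s)=\mathcal{T}(t)\mathcal{T}(s)$; (2) $t\mapsto\mathcal{T}(t)x$ is continuous on $[0,\infty)$ for all $x\in\mathcal{X}$; (3) for every continuous seminorm $p$ and every $a>0$, $x\mapsto\sup_{0\le t\le a}p(\mathcal{T}(t)x)$ is bounded on bounded subsets of $\mathcal{X}$. Its generator is $\mathcal{A}x:=\lim_{t\to0+}\frac1t(\mathcal{T}(t)-I)x$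 (limit in the locally convex topology) with domain $\mathcal{D}_{\mathcal{A}}$ the set where the limit exists. $\mathcal{T}'(t):\mathcal{X}'\to\mathcal{X}'$ is the adjoint of $\mathcal{T}(t)$. A positive $C_b$ semigroup $\mathcal{T}(t)$ is $\pi$-compatible if for every $\varphi\in\mathcal{X}'^+$ the function $t\mapsto\pi(\mathcal{T}'(t)\varphi)$ is continuous. For $\mathcal{F}\subset\mathcal{X}'^+$, an element $z\in\mathcal{X}^+$ is an $L^1$ $\pi$-detector relative to $\mathcal{F}$ if for every $\varphi\in\mathcal{F}$: $\int_0^\infty\langle\varphi,\mathcal{T}(t)z\rangle\,dt<\infty$ implies $\int_0^\infty\pi(\mathcal{T}'(t)\varphi)\,dt<\infty$. A subset $\mathcal{F}\subset\mathcal{X}'^+$ is an $L^1$ $\pi$-stability subset for a class of semigroups if, for every semigroup $\mathcal{T}(t)$ in the class, $\int_0^\infty\pi(\mathcal{T}'(t)\varphi)\,dt<\infty$ for all $\varphi\in\mathcal{F}$ implies the same for all $\varphi\in\mathcal{X}'^+$. *)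

theory Defs
  imports "HOL-Analysis.Analysis"
begin

(* The last clause is convex V spelt out: the constant convex is not available inside a class. *)
class locally_convex_space = real_vector + topological_ab_group_add + t2_space +
  assumes tendsto_scaleR_Pair: "LIM p (nhds c \<times>\<^sub>F nhds x). fst p *\<^sub>R snd p :> nhds (c *\<^sub>R x)"
    and convex_neighbourhood: "open U \<Longrightarrow> 0 \<in> U \<Longrightarrow> \<exists>V. open V \<and> 0 \<in> V \<and> V \<subseteq> U \<and>
      (\<forall>x\<in>V. \<forall>y\<in>V. \<forall>u\<ge>0. \<forall>v\<ge>0. u + v = 1 \<longrightarrow> u *\<^sub>R x + v *\<^sub>R y \<in> V)"

definition seminorm :: "('a::real_vector \<Rightarrow> real) \<Rightarrow> bool" where
  "seminorm p \<longleftrightarrow> (\<forall>x y. p (x + y) \<le> p x + p y) \<and> (\<forall>c x. p (c *\<^sub>R x) = \<bar>c\<bar> * p x)"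

(* Boundedness for the vector space topology; the library's bounded is metric and does not apply. *)
definition tvs_bounded :: "'a::locally_convex_space set \<Rightarrow> bool" where
  "tvs_bounded B \<longleftrightarrow> (\<forall>U. open U \<and> 0 \<in> U \<longrightarrow> (\<exists>r>0. \<forall>s\<ge>r. B \<subseteq> (\<lambda>x. s *\<^sub>R x) ` U))"

definition compact_convex_closures :: "'a::locally_convex_space itself \<Rightarrow> bool" where
  "compact_convex_closures _ \<longleftrightarrow>
     (\<forall>K :: 'a set. compact K \<and> metrizable_space (top_of_set K) \<longrightarrow> compact (closure (convex hull K)))"

definition top_dual :: "('a::locally_convex_space \<Rightarrow> real) set" where
  "top_dual = {\<phi>. linear \<phi> \<and> continuous_on UNIV \<phi>}"

definition banach_norm :: "('a::real_vector \<Rightarrow> real) \<Rightarrow> bool" where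
  "banach_norm \<pi> \<longleftrightarrow> seminorm \<pi> \<and> (\<forall>x. \<pi> x = 0 \<longrightarrow> x = 0) \<and>
     Metric_space.mcomplete UNIV (\<lambda>x y. \<pi> (x - y))"

definition norm_dual :: "('a::real_vector \<Rightarrow> real) \<Rightarrow> ('a \<Rightarrow> real) set" where
  "norm_dual \<pi> = {\<phi>. linear \<phi> \<and> (\<exists>C. \<forall>x. \<bar>\<phi> x\<bar> \<le> C * \<pi> x)}"

(* Meaningful on norm_dual \<pi>, where the supremum is taken over a bounded set of reals. *)
definition dual_norm :: "('a::real_vector \<Rightarrow> real) \<Rightarrow> ('a \<Rightarrow> real) \<Rightarrow> real" where
  "dual_norm \<pi> \<phi> = (SUP x\<in>{x. \<pi> x \<le> 1}. \<bar>\<phi> x\<bar>)"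

(* The topology of 'a is the locally convex one; \<pi> is a second structure on 'a. *)
definition norming_dual_pair :: "('a::locally_convex_space \<Rightarrow> real) \<Rightarrow> bool" where
  "norming_dual_pair \<pi> \<longleftrightarrow> banach_norm \<pi> \<and>
     closedin (Metric_space.mtopology (norm_dual \<pi>) (\<lambda>\<phi> \<psi>. dual_norm \<pi> (\<lambda>x. \<phi> x - \<psi> x))) top_dual \<and>
     (\<forall>x. \<pi> x = (SUP \<phi>\<in>{\<phi> \<in> top_dual. dual_norm \<pi> \<phi> \<le> 1}. \<bar>\<phi> x\<bar>))"

definition closed_proper_cone :: "'a::locally_convex_space set \<Rightarrow> bool" where
  "closed_proper_cone P \<longleftrightarrow> closed P \<and> convex_cone P \<and> P \<inter> uminus ` P = {0}"

definition dual_cone :: "'a::locally_convex_space set \<Rightarrow> ('a \<Rightarrow> real) set" where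
  "dual_cone P = {\<phi> \<in> top_dual. \<forall>x\<in>P. 0 \<le> \<phi> x}"

definition dual_cone_generating :: "'a::locally_convex_space set \<Rightarrow> bool" where
  "dual_cone_generating P \<longleftrightarrow>
     top_dual = {\<lambda>x. \<phi> x - \<psi> x | \<phi> \<psi>. \<phi> \<in> dual_cone P \<and> \<psi> \<in> dual_cone P}"

definition positive_op :: "'a set \<Rightarrow> ('a \<Rightarrow> 'a) \<Rightarrow> bool" where
  "positive_op P L \<longleftrightarrow> L ` P \<subseteq> P"

(* A semigroup is a function on all of real of which only the values at t \<ge> 0 are relevant. *)
definition Cb_semigroup :: "(real \<Rightarrow> 'a::locally_convex_space \<Rightarrow> 'a) \<Rightarrow> bool" where
  "Cb_semigroup T \<longleftrightarrow>
     (\<forall>t\<ge>0. linear (T t) \<and> continuous_on UNIV (T t)) \<and>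
     T 0 = id \<and> (\<forall>t\<ge>0. \<forall>s\<ge>0. T (t + s) = T t \<circ> T s) \<and>
     (\<forall>x. continuous_on {0..} (\<lambda>t. T t x)) \<and>
     (\<forall>p a B. seminorm p \<and> continuous_on UNIV p \<and> 0 < a \<and> tvs_bounded B \<longrightarrow>
        bdd_above {p (T t x) | t x. 0 \<le> t \<and> t \<le> a \<and> x \<in> B})"

definition gen_domain :: "(real \<Rightarrow> 'a::locally_convex_space \<Rightarrow> 'a) \<Rightarrow> 'a set" where
  "gen_domain T = {x. \<exists>y. ((\<lambda>t. (1 / t) *\<^sub>R (T t x - x)) \<longlongrightarrow> y) (at_right 0)}"

definition generator :: "(real \<Rightarrow> 'a::locally_convex_space \<Rightarrow> 'a) \<Rightarrow> 'a \<Rightarrow> 'a" where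
  "generator T x = Lim (at_right 0) (\<lambda>t. (1 / t) *\<^sub>R (T t x - x))"

definition positive_semigroup :: "'a set \<Rightarrow> (real \<Rightarrow> 'a \<Rightarrow> 'a) \<Rightarrow> bool" where
  "positive_semigroup P T \<longleftrightarrow> (\<forall>t\<ge>0. positive_op P (T t))"

abbreviation adjoint_op :: "('a \<Rightarrow> 'a) \<Rightarrow> ('a \<Rightarrow> real) \<Rightarrow> ('a \<Rightarrow> real)" where
  "adjoint_op L \<phi> \<equiv> \<phi> \<circ> L"

definition pi_compatible ::
  "('a::locally_convex_space \<Rightarrow> real) \<Rightarrow> 'a set \<Rightarrow> (real \<Rightarrow> 'a \<Rightarrow> 'a) \<Rightarrow> bool" where
  "pi_compatible \<pi> P T \<longleftrightarrow>
     (\<forall>\<phi>\<in>dual_cone P. continuous_on {0..} (\<lambda>t. dual_norm \<pi> (adjoint_op (T t) \<phi>)))"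

definition L1_norm_finite ::
  "('a::real_vector \<Rightarrow> real) \<Rightarrow> (real \<Rightarrow> 'a \<Rightarrow> 'a) \<Rightarrow> ('a \<Rightarrow> real) \<Rightarrow> bool" where
  "L1_norm_finite \<pi> T \<phi> \<longleftrightarrow>
     (\<integral>\<^sup>+t\<in>{0..}. ennreal (dual_norm \<pi> (adjoint_op (T t) \<phi>)) \<partial>lborel) < \<infinity>"

(* ennreal truncates negative reals to 0; for \<phi> in the dual cone, z in the cone and T positive the
   integrand is nonnegative. *)
definition L1_pi_detector ::
  "('a::locally_convex_space \<Rightarrow> real) \<Rightarrow> 'a set \<Rightarrow> (real \<Rightarrow> 'a \<Rightarrow> 'a) \<Rightarrow> ('a \<Rightarrow> real) set \<Rightarrow> 'a \<Rightarrow> bool" where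
  "L1_pi_detector \<pi> P T F z \<longleftrightarrow> z \<in> P \<and>
     (\<forall>\<phi>\<in>F. (\<integral>\<^sup>+t\<in>{0..}. ennreal (\<phi> (T t z)) \<partial>lborel) < \<infinity> \<longrightarrow> L1_norm_finite \<pi> T \<phi>)"

definition L1_pi_stable ::
  "('a::locally_convex_space \<Rightarrow> real) \<Rightarrow> 'a set \<Rightarrow> (real \<Rightarrow> 'a \<Rightarrow> 'a) \<Rightarrow> bool" where
  "L1_pi_stable \<pi> P T \<longleftrightarrow> (\<forall>\<phi>\<in>dual_cone P. L1_norm_finite \<pi> T \<phi>)"

definition L1_pi_stability_subset ::
  "('a::locally_convex_space \<Rightarrow> real) \<Rightarrow> 'a set \<Rightarrow> (real \<Rightarrow> 'a \<Rightarrow> 'a) set \<Rightarrow> ('a \<Rightarrow> real) set \<Rightarrow> bool" where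
  "L1_pi_stability_subset \<pi> P \<C> F \<longleftrightarrow> F \<subseteq> dual_cone P \<and>
     (\<forall>S\<in>\<C>. (\<forall>\<phi>\<in>F. L1_norm_finite \<pi> S \<phi>) \<longrightarrow> L1_pi_stable \<pi> P S)"

definition exp_pi_stable ::
  "('a::real_vector \<Rightarrow> real) \<Rightarrow> (real \<Rightarrow> 'a \<Rightarrow> 'a) \<Rightarrow> bool" where
  "exp_pi_stable \<pi> T \<longleftrightarrow>
     (\<exists>M>0. \<exists>\<epsilon>>0. \<forall>x. \<forall>t\<ge>0. \<pi> (T t x) \<le> M * exp (- \<epsilon> * t) * \<pi> x)"

definition pi_bounded_op :: "('a::real_vector \<Rightarrow> real) \<Rightarrow> ('a \<Rightarrow> 'a) \<Rightarrow> bool" where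
  "pi_bounded_op \<pi> L \<longleftrightarrow> linear L \<and> (\<exists>C. \<forall>x. \<pi> (L x) \<le> C * \<pi> x)"

end

theory Submission
  imports Defs
begin

text \<open>The proof is the cycle (i) \<open>\<Rightarrow>\<close> (ii') \<open>\<Rightarrow>\<close> (ii) \<open>\<Rightarrow>\<close> (iii) \<open>\<Rightarrow>\<close> (i). A positive solution of \<open>A x = - z\<close> bounds
  \<open>\<integral> \<phi> (T t z) dt\<close> by \<open>\<phi> x\<close>, so the detector and the stability subset give (ii'). Uniform boundedness turns
  (ii') into summability of the norms of the adjoint orbits at integer times and then into a
  uniform bound on the sums \<open>\<Sum>n<N. T n (x n)\<close>, whence the norm of \<open>T n\<close> decays (a discrete Datko
  argument). Under (ii) the inverse is \<open>- \<integral> T t y dt\<close>. Compactness of convex closures provides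
  the weak integrals and, through series \<open>\<Sum>n. c n x n\<close> of bounded sequences, also the uniform
  boundedness of weakly bounded subsets of \<open>X\<close>; Hahn--Banach separation gives positivity.\<close>

text \<open>The locally convex topology and the norm \<open>\<pi>\<close> meet only through
  \<open>top_dual\<close>: orbits are continuous for the former, bounds are wanted for the latter.
  Hence identities are tested against functionals, which separate points because the pair is
  norming, and a bound on \<open>\<pi>\<close> is a bound over functionals of dual norm at most 1.
  Integrals exist only in this weak sense; convergence in the topology itself is recovered from
  their lying in closed convex hulls of orbit pieces. Stability is given for positive functionals
  alone, and the generating dual cone carries it to all of them, as uniform boundedness requires.
  Compatibility with \<open>\<pi>\<close> supplies a bound of \<open>T t\<close> for
  \<open>t\<close> in the unit interval, the bridge between integrals and sums over integer times.
  Sums are preferred to integrals because they allow an arbitrary unit vector \<open>x n\<close> at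
  each time, with no question of measurability in time.\<close>

section \<open>Scalar multiplication and neighbourhoods of zero\<close>

lemma lcs_tendsto_scaleR:
  fixes g :: "'b \<Rightarrow> 'a::locally_convex_space"
  assumes "(f \<longlongrightarrow> c) F" and "(g \<longlongrightarrow> x) F"
  shows "((\<lambda>t. f t *\<^sub>R g t) \<longlongrightarrow> c *\<^sub>R x) F"
proof -
  have "LIM t F. (f t, g t) :> nhds c \<times>\<^sub>F nhds x"
    by (rule filterlim_Pair[OF assms])
  from filterlim_compose[OF tendsto_scaleR_Pair this] show ?thesis by simp
qed

lemma lcs_absorbing:
  fixes x :: "'a::locally_convex_space"
  assumes "open U" "0 \<in> U"
  obtains t where "t > 0" "t *\<^sub>R x \<in> U"
proof -
  have "((\<lambda>t. t *\<^sub>R x) \<longlongrightarrow> 0 *\<^sub>R x) (at_right 0)"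
    by (intro lcs_tendsto_scaleR tendsto_const tendsto_ident_at)
  then have "eventually (\<lambda>t. t *\<^sub>R x \<in> U) (at_right 0)"
    using assms by (auto dest: topological_tendstoD)
  then have "eventually (\<lambda>t. 0 < t \<and> t *\<^sub>R x \<in> U) (at_right 0)"
    using eventually_at_right_less[of "0::real"] by eventually_elim auto
  then have "\<exists>t>0. t *\<^sub>R x \<in> U"
    using eventually_happens[of _ "at_right (0::real)"] by auto
  then show ?thesis using that by blast
qed

text \<open>Symmetry turns one-sided bounds of linear functionals into absolute ones and, together
  with convexity, makes the neighbourhood stable under scalars of modulus at most 1.\<close>

lemma convex_symmetric_neighbourhood:
  fixes U :: "'a::locally_convex_space set"
  assumes "open U" "0 \<in> U"
  obtains V where "open V" "0 \<in> V" "V \<subseteq> U" "convex V" "\<And>x. x \<in> V \<Longrightarrow> - x \<in> V"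
proof -
  obtain W where W: "open W" "0 \<in> W" "W \<subseteq> U"
    "\<forall>x\<in>W. \<forall>y\<in>W. \<forall>u\<ge>0. \<forall>v\<ge>0. u + v = 1 \<longrightarrow> u *\<^sub>R x + v *\<^sub>R y \<in> W"
    using convex_neighbourhood[OF assms] by blast
  define V where "V = W \<inter> uminus -` W"
  have "open (uminus -` W)"
    by (rule open_vimage[OF W(1)]) (intro continuous_intros)
  then have "open V" using W by (auto simp: V_def)
  moreover have "convex V"
    unfolding convex_def
  proof (intro ballI allI impI)
    fix x y and u v :: real
    assume *: "x \<in> V" "y \<in> V" "0 \<le> u" "0 \<le> v" "u + v = 1"
    have "u *\<^sub>R x + v *\<^sub>R y \<in> W" using * W(4) by (auto simp: V_def)
    moreover have "u *\<^sub>R (- x) + v *\<^sub>R (- y) \<in> W" using * W(4) unfolding V_def by blast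
    ultimately show "u *\<^sub>R x + v *\<^sub>R y \<in> V"
      by (auto simp: V_def)
  qed
  ultimately show ?thesis using W that[of V] by (auto simp: V_def)
qed

lemma convex_symmetric_scale:
  assumes "convex V" "0 \<in> V" "\<And>x. x \<in> V \<Longrightarrow> - x \<in> V" "x \<in> V" "\<bar>c\<bar> \<le> 1"
  shows "c *\<^sub>R x \<in> V"
proof -
  have *: "d *\<^sub>R y \<in> V" if "y \<in> V" "0 \<le> d" "d \<le> 1" for d y
    using convexD[OF assms(1) that(1) assms(2), of d "1 - d"] that by simp
  show ?thesis
  proof (cases "c \<ge> 0")
    case False
    then show ?thesis using *[of "- x" "- c"] assms by simp
  qed (use * assms in auto)
qed

section \<open>Hahn--Banach separation\<close>

text \<open>Homogeneity is required only as an inequality for \<open>c > 0\<close>, which is easy to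
  check for infima; the reverse inequality follows by scaling with \<open>inverse c\<close>.\<close>

definition sublinear :: "('a::real_vector \<Rightarrow> real) \<Rightarrow> bool" where
  "sublinear q \<longleftrightarrow> (\<forall>x y. q (x + y) \<le> q x + q y) \<and> (\<forall>c>0. \<forall>x. q (c *\<^sub>R x) \<le> c * q x)"

lemma sublinearD:
  assumes "sublinear q"
  shows "q (x + y) \<le> q x + q y" and "c > 0 \<Longrightarrow> q (c *\<^sub>R x) = c * q x" and "q 0 = 0"
    and "- q (- x) \<le> q x"
proof -
  show add: "q (x + y) \<le> q x + q y" for x y using assms by (simp add: sublinear_def)
  have le: "c > 0 \<Longrightarrow> q (c *\<^sub>R x) \<le> c * q x" for c x using assms by (simp add: sublinear_def)
  show "q (c *\<^sub>R x) = c * q x" if "c > 0"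
  proof -
    have "q x \<le> inverse c * q (c *\<^sub>R x)"
      using le[of "inverse c" "c *\<^sub>R x"] that by simp
    then show ?thesis using le[OF that, of x] that by (simp add: field_simps)
  qed
  show zero: "q 0 = 0" using le[of 2 0] le[of "1/2" 0] by simp
  show "- q (- x) \<le> q x" using add[of x "- x"] zero by simp
qed

text \<open>Lowering \<open>q\<close> along the ray through \<open>y\<close> makes it additive in
  that direction: any linear functional below \<open>r\<close> takes a value of at least
  \<open>q y\<close> at \<open>y\<close>. This serves both the linearity of minimal functionals and
  the choice of a functional attaining \<open>q\<close> at a point.\<close>

lemma sublinear_shift:
  fixes q :: "'a::real_vector \<Rightarrow> real" and y :: 'a
  assumes q: "sublinear q"
  defines "r \<equiv> \<lambda>x. INF t\<in>{0..}. q (x + t *\<^sub>R y) - t * q y"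
  shows "sublinear r" and "r x \<le> q x" and "r (- y) \<le> - q y"
proof -
  note [simp] = sublinearD(3)[OF q]
  \<comment> \<open>The infimum of reals is meaningful only with this lower bound, which
    subadditivity gives as \<open>- q (- x)\<close>.\<close>
  have bdd: "bdd_below ((\<lambda>t. q (x + t *\<^sub>R y) - t * q y) ` {0..})" for x
  proof (rule bdd_belowI2)
    fix t :: real assume t: "t \<in> {0..}"
    have "t * q y = q (t *\<^sub>R y)"
      using t sublinearD(2)[OF q, of t y] by (cases "t = 0") auto
    also have "\<dots> \<le> q (x + t *\<^sub>R y) + q (- x)"
      using sublinearD(1)[OF q, of "x + t *\<^sub>R y" "- x"] by simp
    finally show "- q (- x) \<le> q (x + t *\<^sub>R y) - t * q y" by simp
  qed
  have le: "r x \<le> q (x + t *\<^sub>R y) - t * q y" if "t \<ge> 0" for t x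
    unfolding r_def by (rule cINF_lower[OF bdd]) (use that in auto)
  show "r x \<le> q x" using le[of 0 x] by simp
  show "r (- y) \<le> - q y" using le[of 1 "- y"] by simp
  show "sublinear r"
    unfolding sublinear_def
  proof (intro conjI allI impI)
    fix x x'
    have "r (x + x') - (q (x' + t' *\<^sub>R y) - t' * q y) \<le> r x" if "t' \<ge> 0" for t'
      unfolding r_def[THEN meta_eq_to_obj_eq, THEN fun_cong, of x]
    proof (rule cINF_greatest)
      fix t :: real assume t: "t \<in> {0..}"
      have "r (x + x') \<le> q ((x + x') + (t + t') *\<^sub>R y) - (t + t') * q y"
        using le that t by simp
      also have "(x + x') + (t + t') *\<^sub>R y = (x + t *\<^sub>R y) + (x' + t' *\<^sub>R y)"
        by (simp add: algebra_simps)
      also have "q \<dots> \<le> q (x + t *\<^sub>R y) + q (x' + t' *\<^sub>R y)"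
        by (rule sublinearD(1)[OF q])
      finally show "r (x + x') - (q (x' + t' *\<^sub>R y) - t' * q y) \<le> q (x + t *\<^sub>R y) - t * q y"
        by (simp add: algebra_simps)
    qed simp
    then have "r (x + x') - r x \<le> q (x' + t' *\<^sub>R y) - t' * q y" if "t' \<ge> 0" for t'
      using that by (simp add: algebra_simps)
    then have "r (x + x') - r x \<le> r x'"
      unfolding r_def[THEN meta_eq_to_obj_eq, THEN fun_cong, of x']
      by (intro cINF_greatest) auto
    then show "r (x + x') \<le> r x + r x'" by simp
  next
    fix c :: real and x assume c: "c > 0"
    have "r (c *\<^sub>R x) / c \<le> r x"
      unfolding r_def[THEN meta_eq_to_obj_eq, THEN fun_cong, of x]
    proof (rule cINF_greatest)
      fix t :: real assume t: "t \<in> {0..}"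
      have "r (c *\<^sub>R x) \<le> q (c *\<^sub>R x + (c * t) *\<^sub>R y) - (c * t) * q y"
        using le t c by simp
      also have "c *\<^sub>R x + (c * t) *\<^sub>R y = c *\<^sub>R (x + t *\<^sub>R y)"
        by (simp add: algebra_simps)
      also have "q \<dots> = c * q (x + t *\<^sub>R y)" by (rule sublinearD(2)[OF q c])
      finally show "r (c *\<^sub>R x) / c \<le> q (x + t *\<^sub>R y) - t * q y"
        using c by (simp add: field_simps)
    qed simp
    then show "r (c *\<^sub>R x) \<le> c * r x" using c by (simp add: field_simps)
  qed
qed

text \<open>A minimal sublinear functional is linear, because the functional of
  \<open>sublinear_shift\<close> cannot lie strictly below it.\<close>

lemma minimal_sublinear_linear:
  assumes m: "sublinear m" and min: "\<And>s. sublinear s \<Longrightarrow> s \<le> m \<Longrightarrow> s = m"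
  shows "linear m"
proof -
  have neg: "m (- y) = - m y" for y
  proof -
    let ?r = "\<lambda>x. INF t\<in>{0..}. m (x + t *\<^sub>R y) - t * m y"
    have "?r = m"
      by (intro min sublinear_shift[OF m] le_funI)
    then have "?r (- y) = m (- y)" by (rule fun_cong)
    then have "m (- y) \<le> - m y" using sublinear_shift(3)[OF m, of y] by linarith
    then show ?thesis using sublinearD(4)[OF m, of y] by simp
  qed
  have add: "m (x + y) = m x + m y" for x y
    using sublinearD(1)[OF m, of x y] sublinearD(1)[OF m, of "x + y" "- y"] neg[of y] by simp
  have scale: "m (c *\<^sub>R x) = c * m x" for c x
  proof (cases c "0::real" rule: linorder_cases)
    case less
    then show ?thesis using sublinearD(2)[OF m, of "- c" x] neg[of "c *\<^sub>R x"] by simp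
  next
    case equal
    then show ?thesis using sublinearD(3)[OF m] by simp
  next
    case greater
    then show ?thesis by (rule sublinearD(2)[OF m])
  qed
  show ?thesis by (rule linearI) (auto simp: add scale)
qed

text \<open>A minimal sublinear functional below \<open>q\<close> exists by Zorn's lemma. The
  relation \<open>R\<close> reverses the order because Zorn yields maximal elements; upper bounds of
  chains are then pointwise infima.\<close>

lemma sublinear_dominates_linear:
  assumes q: "sublinear q"
  obtains f where "linear f" "\<And>x. f x \<le> q x"
proof -
  define A where "A = {s. sublinear s \<and> s \<le> q}"
  define R where "R = (\<lambda>a b :: 'a \<Rightarrow> real. b \<le> a)"
  have "\<exists>m\<in>A. \<forall>a\<in>A. R m a \<longrightarrow> a = m"
  proof (rule predicate_Zorn)
    show "partial_order_on A (relation_of R A)"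
      by (rule partial_order_on_relation_ofI) (auto simp: R_def)
  next
    fix C assume "C \<in> Chains (relation_of R A)"
    then have CA: "C \<subseteq> A" and chain: "\<And>s t. s \<in> C \<Longrightarrow> t \<in> C \<Longrightarrow> s \<le> t \<or> t \<le> s"
      by (auto simp: Chains_def relation_of_def R_def)
    show "\<exists>u\<in>A. \<forall>a\<in>C. R a u"
    proof (cases "C = {}")
      case True
      then show ?thesis using q by (auto simp: A_def)
    next
      case False
      define u where "u = (\<lambda>x. INF s\<in>C. s x)"
      have sub: "sublinear s" "s \<le> q" if "s \<in> C" for s using that CA by (auto simp: A_def)
      have bdd: "bdd_below ((\<lambda>s. s x) ` C)" for x
      proof (rule bdd_belowI2)
        fix s assume s: "s \<in> C"
        have "- q (- x) \<le> - s (- x)" using sub(2)[OF s] by (simp add: le_fun_def)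
        also have "\<dots> \<le> s x" by (rule sublinearD(4)[OF sub(1)[OF s]])
        finally show "- q (- x) \<le> s x" .
      qed
      have le: "u x \<le> s x" if "s \<in> C" for s x
        unfolding u_def by (rule cINF_lower[OF bdd that])
      have ge: "d \<le> u x" if "\<And>s. s \<in> C \<Longrightarrow> d \<le> s x" for d x
        unfolding u_def by (rule cINF_greatest[OF False that])
      have "sublinear u"
        unfolding sublinear_def
      proof (intro conjI allI impI)
        fix x y
        \<comment> \<open>Subadditivity survives the infimum because the smaller of the two chain
          members \<open>s\<close> and \<open>t\<close> serves for both summands.\<close>
        have st: "u (x + y) \<le> s x + t y" if s: "s \<in> C" and t: "t \<in> C" for s t
        proof -
          obtain w where w: "w \<in> C" "w \<le> s" "w \<le> t" using chain[OF s t] s t by blast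
          have "u (x + y) \<le> w x + w y"
            using le[OF w(1)] sublinearD(1)[OF sub(1)[OF w(1)]] order_trans by blast
          also have "\<dots> \<le> s x + t y" using w by (intro add_mono) (auto simp: le_fun_def)
          finally show ?thesis .
        qed
        have "u (x + y) - t y \<le> u x" if "t \<in> C" for t
          using st[OF _ that] by (intro ge) (simp add: algebra_simps)
        then have "u (x + y) - u x \<le> u y"
          by (intro ge) (simp add: algebra_simps)
        then show "u (x + y) \<le> u x + u y" by simp
      next
        fix c :: real and x assume c: "c > 0"
        have "u (c *\<^sub>R x) / c \<le> u x"
        proof (rule ge)
          fix s assume s: "s \<in> C"
          show "u (c *\<^sub>R x) / c \<le> s x"
            using le[OF s, of "c *\<^sub>R x"] sublinearD(2)[OF sub(1)[OF s] c, of x] c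
            by (simp add: field_simps)
        qed
        then show "u (c *\<^sub>R x) \<le> c * u x" using c by (simp add: field_simps)
      qed
      moreover have "u \<le> q" using False le sub(2) by (meson ex_in_conv le_funI le_funD order_trans)
      ultimately show ?thesis using le by (intro bexI[of _ u]) (auto simp: A_def R_def le_fun_def)
    qed
  qed
  then obtain m where m: "m \<in> A" "\<And>a. a \<in> A \<Longrightarrow> a \<le> m \<Longrightarrow> a = m" by (auto simp: R_def)
  have "linear m"
    using m by (intro minimal_sublinear_linear) (auto simp: A_def)
  then show ?thesis using that m(1) by (auto simp: A_def le_fun_def)
qed

text \<open>Dominating the shifted functional instead of \<open>q\<close> gives
  \<open>f (- y) \<le> - q y\<close>, which is the missing inequality at \<open>y\<close>.\<close>

lemma sublinear_dominates_linear_eq: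
  assumes q: "sublinear q"
  obtains f where "linear f" "\<And>x. f x \<le> q x" "f y = q y"
proof -
  obtain f where f: "linear f" "\<And>x. f x \<le> (INF t\<in>{0..}. q (x + t *\<^sub>R y) - t * q y)"
    using sublinear_dominates_linear[OF sublinear_shift(1)[OF q]] by metis
  have le: "f x \<le> q x" for x using f(2)[of x] sublinear_shift(2)[OF q, of x y] by linarith
  have "f (- y) \<le> - q y" using f(2)[of "- y"] sublinear_shift(3)[OF q, of y] by linarith
  then have "f y = q y" using le[of y] linear_neg[OF f(1), of y] by simp
  then show ?thesis using that f(1) le by blast
qed

section \<open>Gauges of convex sets and separation by continuous functionals\<close>

definition minkowski_functional :: "'a::real_vector set \<Rightarrow> 'a \<Rightarrow> real" where
  "minkowski_functional C x = Inf {t. t > 0 \<and> inverse t *\<^sub>R x \<in> C}"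

context
  fixes C :: "'a::real_vector set"
  assumes convex: "convex C" and zero: "0 \<in> C" and absorbing: "\<And>x. \<exists>t>0. t *\<^sub>R x \<in> C"
begin

private lemma bdd_minkowski: "bdd_below {t. t > 0 \<and> inverse t *\<^sub>R x \<in> C}"
  by (rule bdd_belowI[of _ 0]) auto

private lemma minkowski_le: "t > 0 \<Longrightarrow> inverse t *\<^sub>R x \<in> C \<Longrightarrow> minkowski_functional C x \<le> t"
  unfolding minkowski_functional_def by (rule cInf_lower[OF _ bdd_minkowski]) simp

private lemma minkowski_nonneg: "minkowski_functional C x \<ge> 0"
  unfolding minkowski_functional_def
proof (rule cInf_greatest)
  obtain t where "t > 0" "t *\<^sub>R x \<in> C" using absorbing by blast
  then have "inverse t \<in> {t. t > 0 \<and> inverse t *\<^sub>R x \<in> C}" by simp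
  then show "{t. t > 0 \<and> inverse t *\<^sub>R x \<in> C} \<noteq> {}" by blast
qed auto

private lemma minkowski_less:
  assumes "minkowski_functional C x < t"
  shows "inverse t *\<^sub>R x \<in> C"
proof -
  obtain u where "u > 0" "u *\<^sub>R x \<in> C" using absorbing by blast
  then have "inverse u \<in> {t. t > 0 \<and> inverse t *\<^sub>R x \<in> C}" by simp
  then obtain s where s: "s > 0" "inverse s *\<^sub>R x \<in> C" "s < t"
    using assms unfolding minkowski_functional_def
    by (subst (asm) cInf_less_iff[OF _ bdd_minkowski]) blast+
  have "(s / t) *\<^sub>R (inverse s *\<^sub>R x) + (1 - s / t) *\<^sub>R 0 \<in> C"
    by (rule convexD[OF convex s(2) zero]) (use s in auto)
  then show ?thesis using s by (simp add: field_simps)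
qed

lemma sublinear_minkowski_functional: "sublinear (minkowski_functional C)"
  unfolding sublinear_def
proof (intro conjI allI impI)
  fix x y
  show "minkowski_functional C (x + y) \<le> minkowski_functional C x + minkowski_functional C y"
  proof (rule field_le_epsilon)
    fix e :: real assume e: "e > 0"
    define s t where "s = minkowski_functional C x + e / 2"
      and "t = minkowski_functional C y + e / 2"
    have st: "s > 0" "t > 0"
      using e minkowski_nonneg[of x] minkowski_nonneg[of y] by (auto simp: s_def t_def)
    have "(s / (s + t)) *\<^sub>R (inverse s *\<^sub>R x) + (t / (s + t)) *\<^sub>R (inverse t *\<^sub>R y) \<in> C"
      by (rule convexD[OF convex minkowski_less minkowski_less])
        (use st e in \<open>auto simp: s_def t_def add_divide_distrib[symmetric]\<close>)
    then have "inverse (s + t) *\<^sub>R (x + y) \<in> C"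
      using st by (simp add: field_simps scaleR_add_right)
    then have "minkowski_functional C (x + y) \<le> s + t"
      using st by (intro minkowski_le) auto
    then show "minkowski_functional C (x + y)
        \<le> minkowski_functional C x + minkowski_functional C y + e"
      by (simp add: s_def t_def)
  qed
next
  fix c :: real and x assume c: "c > 0"
  have "minkowski_functional C (c *\<^sub>R x) / c \<le> minkowski_functional C x"
  proof (rule dense_ge)
    fix t assume t: "minkowski_functional C x < t"
    have "inverse (c * t) *\<^sub>R (c *\<^sub>R x) = inverse t *\<^sub>R x" using c by simp
    then have "inverse (c * t) *\<^sub>R (c *\<^sub>R x) \<in> C" using minkowski_less[OF t] by (simp only:)
    then have "minkowski_functional C (c *\<^sub>R x) \<le> c * t"
      using c t minkowski_nonneg[of x] by (intro minkowski_le) auto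
    then show "minkowski_functional C (c *\<^sub>R x) / c \<le> t" using c by (simp add: field_simps)
  qed
  then show "minkowski_functional C (c *\<^sub>R x) \<le> c * minkowski_functional C x"
    using c by (simp add: field_simps)
qed

lemma minkowski_functional_le_1: "x \<in> C \<Longrightarrow> minkowski_functional C x \<le> 1"
  using minkowski_le[of 1 x] by simp

lemma minkowski_functional_ge_1: "x \<notin> C \<Longrightarrow> minkowski_functional C x \<ge> 1"
  using minkowski_less[of x 1] by force

end

text \<open>A one-sided bound on some neighbourhood becomes two-sided on a symmetric one, and
  scaling that neighbourhood makes differences of \<open>f\<close> small. The factor
  \<open>2 / e\<close> leaves room for a strict inequality.\<close>

lemma linear_le_1_imp_continuous:
  fixes f :: "'a::locally_convex_space \<Rightarrow> real"
  assumes f: "linear f" and V: "open V" "0 \<in> V" "\<And>x. x \<in> V \<Longrightarrow> f x \<le> 1"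
  shows "continuous_on UNIV f"
proof -
  obtain W where W: "open W" "0 \<in> W" "W \<subseteq> V" "convex W" "\<And>x. x \<in> W \<Longrightarrow> - x \<in> W"
    using convex_symmetric_neighbourhood[OF V(1,2)] by blast
  have abs: "\<bar>f x\<bar> \<le> 1" if "x \<in> W" for x
    using V(3)[of x] V(3)[of "- x"] W(3,5) that linear_neg[OF f, of x] by fastforce
  have "(f \<longlongrightarrow> f a) (at a)" for a
  proof (rule tendstoI)
    fix e :: real assume e: "e > 0"
    have "((\<lambda>x. (2 / e) *\<^sub>R (x - a)) \<longlongrightarrow> (2 / e) *\<^sub>R (a - a)) (at a)"
      by (intro lcs_tendsto_scaleR tendsto_intros)
    then have "eventually (\<lambda>x. (2 / e) *\<^sub>R (x - a) \<in> W) (at a)"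
      using W by (auto dest: topological_tendstoD)
    then show "eventually (\<lambda>x. dist (f x) (f a) < e) (at a)"
    proof eventually_elim
      case (elim x)
      have "\<bar>2 / e * (f x - f a)\<bar> \<le> 1"
        using abs[OF elim] by (simp add: linear_scale[OF f] linear_diff[OF f])
      then show ?case using e by (auto simp: abs_mult field_simps dist_real_def)
    qed
  qed
  then show ?thesis by (simp add: continuous_on_def)
qed

text \<open>The Hahn--Banach functional attains the gauge of \<open>C\<close> at \<open>x\<close>,
  where the gauge is at least 1 because \<open>x\<close> lies outside. It is at most 1 on
  \<open>C\<close>, hence on \<open>V\<close>, and this makes it continuous.\<close>

lemma separation_from_convex_neighbourhood:
  fixes C :: "'a::locally_convex_space set"
  assumes "convex C" "open V" "0 \<in> V" "V \<subseteq> C" "x \<notin> C"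
  obtains \<phi> where "\<phi> \<in> top_dual" "\<And>y. y \<in> C \<Longrightarrow> \<phi> y \<le> 1" "\<phi> x \<ge> 1"
proof -
  have abs: "\<exists>t>0. t *\<^sub>R y \<in> C" for y
    using lcs_absorbing[OF assms(2,3), of y] assms(4) by blast
  have zero: "0 \<in> C" using assms by auto
  obtain f where f: "linear f" "\<And>y. f y \<le> minkowski_functional C y" "f x = minkowski_functional C x"
    using sublinear_dominates_linear_eq[OF sublinear_minkowski_functional[OF assms(1) zero abs]]
    by metis
  have le: "f y \<le> 1" if "y \<in> C" for y
    using f(2)[of y] minkowski_functional_le_1[OF assms(1) zero abs that] by simp
  have "f \<in> top_dual"
    using linear_le_1_imp_continuous[OF f(1) assms(2,3)] le assms(4) f(1)
    by (auto simp: top_dual_def)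
  moreover have "f x \<ge> 1"
    using minkowski_functional_ge_1[OF assms(1) zero abs assms(5)] f(3) by simp
  ultimately show ?thesis using that le by blast
qed

text \<open>This is the bipolar theorem for cones; it converts positivity against the dual cone into
  membership in \<open>P\<close>.\<close>

lemma mem_closed_convex_cone:
  fixes P :: "'a::locally_convex_space set"
  assumes P: "closed P" "convex_cone P" and w: "\<And>\<phi>. \<phi> \<in> dual_cone P \<Longrightarrow> 0 \<le> \<phi> w"
  shows "w \<in> P"
proof (rule ccontr)
  assume wP: "w \<notin> P"
  have cone: "convex P" "\<And>x c. x \<in> P \<Longrightarrow> c \<ge> 0 \<Longrightarrow> c *\<^sub>R x \<in> P" "P \<noteq> {}"
    using P(2) by (auto simp: convex_cone_def conic_def)
  then have zero: "0 \<in> P" by fastforce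
  have "open ((\<lambda>v. w + v) -` (- P))"
    by (rule open_vimage) (use P in \<open>auto intro!: continuous_intros\<close>)
  then obtain V where V: "open V" "0 \<in> V" "V \<subseteq> (\<lambda>v. w + v) -` (- P)" "convex V"
    "\<And>x. x \<in> V \<Longrightarrow> - x \<in> V"
    using convex_symmetric_neighbourhood[of "(\<lambda>v. w + v) -` (- P)"] wP by auto
  \<comment> \<open>Thickening \<open>- P\<close> by \<open>V\<close> gives a convex neighbourhood
    of 0. It misses \<open>- w\<close> because \<open>w + V\<close> is disjoint from
    \<open>P\<close>.\<close>
  define C where "C = (\<Union>v\<in>V. \<Union>p\<in>P. {v - p})"
  have "convex C" unfolding C_def by (rule convex_differences[OF V(4) cone(1)])
  moreover have "V \<subseteq> C" using zero by (force simp: C_def)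
  moreover have "- w \<notin> C"
  proof
    assume "- w \<in> C"
    then obtain v p where "v \<in> V" "p \<in> P" "- w = v - p" by (auto simp: C_def)
    then have "w = p - v" by (metis minus_diff_eq minus_minus)
    then have "w + v = p" by simp
    then show False using V(3) \<open>v \<in> V\<close> \<open>p \<in> P\<close> by auto
  qed
  ultimately obtain \<phi> where \<phi>: "\<phi> \<in> top_dual" "\<And>y. y \<in> C \<Longrightarrow> \<phi> y \<le> 1" "\<phi> (- w) \<ge> 1"
    using separation_from_convex_neighbourhood[of C V] V by metis
  have lin: "linear \<phi>" using \<phi>(1) by (simp add: top_dual_def)
  have "\<phi> p \<ge> 0" if "p \<in> P" for p
  proof (rule ccontr)
    assume neg: "\<not> \<phi> p \<ge> 0"
    \<comment> \<open>A functional bounded above on \<open>- P\<close> must be nonnegative on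
      \<open>P\<close>: with this \<open>c\<close> its value at \<open>- c *\<^sub>R p\<close> would
      be 2, above the bound 1.\<close>
    define c where "c = - 2 / \<phi> p"
    have "c \<ge> 0" using neg by (simp add: c_def divide_nonpos_neg)
    then have "0 - c *\<^sub>R p \<in> C" using cone(2)[OF that] V(2) unfolding C_def by blast
    then have "- (c * \<phi> p) \<le> 1"
      using \<phi>(2)[of "0 - c *\<^sub>R p"] linear_neg[OF lin, of "c *\<^sub>R p"] linear_scale[OF lin, of c p] by simp
    then show False using neg by (simp add: c_def)
  qed
  then have "\<phi> \<in> dual_cone P" using \<phi>(1) by (simp add: dual_cone_def)
  then have "0 \<le> \<phi> w" by (rule w)
  then show False using \<phi>(3) linear_neg[OF lin, of w] by simp
qed

section \<open>Uniform boundedness\<close>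

text \<open>The sign \<open>s k\<close> is chosen so that the \<open>k\<close>-th term of the series at \<open>x k\<close> is not
  cancelled by the previous ones; the geometric weights make the remaining terms too small to
  compensate (Sokal's proof of the uniform boundedness principle).\<close>

lemma gliding_hump:
  fixes b :: "'x \<Rightarrow> 'f \<Rightarrow> real"
  assumes bdd: "\<And>x. x \<in> A \<Longrightarrow> \<exists>c. \<forall>f\<in>D. \<bar>b x f\<bar> \<le> c"
    and unb: "\<And>N. \<exists>x\<in>A. \<exists>f\<in>D. \<bar>b x f\<bar> > N"
  obtains x f and s :: "nat \<Rightarrow> real"
  where "\<And>k. x k \<in> A" "\<And>k. f k \<in> D" "\<And>k. \<bar>s k\<bar> = 1"
    and "\<And>k. \<bar>\<Sum>j. s j * (1/3) ^ j * b (x k) (f j)\<bar> \<ge> (4/3) ^ k / 4"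
proof -
  define c where "c = (\<lambda>x. SUP f\<in>D. \<bar>b x f\<bar>)"
  have bdd': "bdd_above ((\<lambda>f. \<bar>b x f\<bar>) ` D)" if "x \<in> A" for x
    using bdd[OF that] by (auto simp: bdd_above_def)
  have le_c: "\<bar>b x f\<bar> \<le> c x" if "x \<in> A" "f \<in> D" for x f
    unfolding c_def by (rule cSUP_upper[OF that(2) bdd'[OF that(1)]])
  \<comment> \<open>The constants fit the weights \<open>(1/3) ^ j\<close>: the tail behind index
    \<open>k\<close> amounts to at most half of \<open>(1/3) ^ k * c (x k)\<close>, so a main term
    of three quarters leaves one quarter, and growth like \<open>4 ^ k\<close> beats the
    weight.\<close>
  have "\<exists>x f. x \<in> A \<and> f \<in> D \<and> c x \<ge> 4 ^ k \<and> \<bar>b x f\<bar> \<ge> 3/4 * c x" for k :: nat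
  proof -
    obtain x g where xg: "x \<in> A" "g \<in> D" "\<bar>b x g\<bar> > 4 ^ k" using unb by blast
    have ge: "c x \<ge> 4 ^ k" using le_c[OF xg(1,2)] xg(3) by simp
    moreover have "(0::real) < 4 ^ k" by simp
    ultimately have "3/4 * c x < c x" by linarith
    then obtain f where "f \<in> D" "3/4 * c x < \<bar>b x f\<bar>"
      unfolding c_def using less_cSUP_iff[OF _ bdd'[OF xg(1)]] xg(2) by blast
    then show ?thesis using xg ge by (intro exI[of _ x] exI[of _ f]) auto
  qed
  then obtain x f where x: "\<And>k. x k \<in> A" and f: "\<And>k. f k \<in> D"
    and c4: "\<And>k. c (x k) \<ge> 4 ^ k" and near: "\<And>k. \<bar>b (x k) (f k)\<bar> \<ge> 3/4 * c (x k)"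
    by metis
  define a where "a = (\<lambda>k j. (1/3) ^ j * b (x k) (f j))"
  \<comment> \<open>Each sign depends on all earlier ones, so the recursion carries the signs chosen
    so far as a function; \<open>s\<close> reads off its diagonal.\<close>
  define g where "g = rec_nat (\<lambda>_. 0 :: real)
     (\<lambda>k h. h(k := if \<bar>(\<Sum>j<k. h j * a k j) + a k k\<bar> \<ge> \<bar>a k k\<bar> then 1 else - 1))"
  define s where "s = (\<lambda>j. g (Suc j) j)"
  have g_Suc: "g (Suc k) = (g k)(k := if \<bar>(\<Sum>j<k. g k j * a k j) + a k k\<bar> \<ge> \<bar>a k k\<bar> then 1 else - 1)" for k
    by (simp add: g_def)
  have g_s: "g k j = s j" if "j < k" for k j
    using that by (induction k) (auto simp: s_def g_Suc less_Suc_eq)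
  have s1: "\<bar>s k\<bar> = 1" for k by (simp add: s_def g_Suc)
  \<comment> \<open>For reals \<open>S\<close> and \<open>a\<close>, at least one of
    \<open>S + a\<close> and \<open>S - a\<close> has modulus at least that of
    \<open>a\<close>.\<close>
  have hump: "\<bar>\<Sum>j<Suc k. s j * a k j\<bar> \<ge> \<bar>a k k\<bar>" for k
  proof -
    have "s k = (if \<bar>(\<Sum>j<k. g k j * a k j) + a k k\<bar> \<ge> \<bar>a k k\<bar> then 1 else - 1)"
      by (simp add: s_def g_Suc)
    also have "(\<Sum>j<k. g k j * a k j) = (\<Sum>j<k. s j * a k j)"
      by (rule sum.cong) (auto simp: g_s)
    finally have "s k = (if \<bar>(\<Sum>j<k. s j * a k j) + a k k\<bar> \<ge> \<bar>a k k\<bar> then 1 else - 1)" .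
    then show ?thesis by (auto simp: abs_if split: if_splits)
  qed
  have c0: "c (x k) \<ge> 0" for k using c4[of k] zero_le_power[of "4::real" k] by linarith
  have bound: "\<bar>s j * a k j\<bar> \<le> c (x k) * (1/3) ^ j" for j k
    using le_c[OF x[of k] f[of j]] c0[of k] by (simp add: a_def abs_mult s1 mult.commute mult_left_mono)
  have summ: "summable (\<lambda>j. s j * a k j)" for k
    by (rule summable_comparison_test'[of "\<lambda>j. c (x k) * (1/3) ^ j" 0]) (use bound in \<open>auto intro!: summable_mult\<close>)
  have "\<bar>\<Sum>j. s j * a k j\<bar> \<ge> (4/3) ^ k / 4" for k
  proof -
    have tail: "\<bar>\<Sum>j. s (j + Suc k) * a k (j + Suc k)\<bar> \<le> c (x k) * (1/3) ^ k / 2"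
    proof -
      have sm: "(\<lambda>j. c (x k) * (1/3) ^ Suc k * (1/3) ^ j) sums (c (x k) * (1/3) ^ Suc k * (1 / (1 - 1/3)))"
        by (intro sums_mult geometric_sums) simp
      have "norm (\<Sum>j. s (j + Suc k) * a k (j + Suc k)) \<le> (\<Sum>j. c (x k) * (1/3) ^ Suc k * (1/3) ^ j)"
      proof (rule norm_suminf_le[OF _ sums_summable[OF sm]])
        show "norm (s (j + Suc k) * a k (j + Suc k)) \<le> c (x k) * (1/3) ^ Suc k * (1/3) ^ j" for j
          using bound[of "j + Suc k" k] by (simp add: power_add mult.assoc mult.commute mult.left_commute)
      qed
      then show ?thesis using sums_unique[OF sm] by simp
    qed
    have "(\<Sum>j. s j * a k j) = (\<Sum>j. s (j + Suc k) * a k (j + Suc k)) + (\<Sum>j<Suc k. s j * a k j)"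
      by (rule suminf_split_initial_segment[OF summ])
    moreover have "\<bar>a k k\<bar> \<ge> (1/3) ^ k * (3/4 * c (x k))"
      using near[of k] unfolding a_def abs_mult by simp
    then have "\<bar>a k k\<bar> \<ge> 3/4 * ((1/3) ^ k * c (x k))" by (simp only: mult.left_commute)
    moreover have "c (x k) * (1/3) ^ k / 2 = 1/2 * ((1/3) ^ k * c (x k))" by simp
    ultimately have "\<bar>\<Sum>j. s j * a k j\<bar> \<ge> (1/3) ^ k * c (x k) / 4"
      using tail hump[of k] by linarith
    moreover have "(1/3) ^ k * c (x k) \<ge> (1/3) ^ k * 4 ^ k" using c4 by (intro mult_left_mono) auto
    moreover have "(1/3 :: real) ^ k * 4 ^ k = (4/3) ^ k" by (simp flip: power_mult_distrib)
    ultimately show ?thesis by linarith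
  qed
  then have "\<bar>\<Sum>j. s j * (1/3) ^ j * b (x k) (f j)\<bar> \<ge> (4/3) ^ k / 4" for k
    by (simp only: a_def mult.assoc)
  then show ?thesis by (rule that[OF x f s1])
qed

lemma top_dualD:
  assumes "\<phi> \<in> top_dual"
  shows "linear \<phi>" "continuous_on S \<phi>" "(f \<longlongrightarrow> x) G \<Longrightarrow> ((\<lambda>t. \<phi> (f t)) \<longlongrightarrow> \<phi> x) G"
  using assms continuous_on_subset[of UNIV \<phi> S] continuous_on_tendsto_compose[of UNIV \<phi> f x G]
  by (auto simp: top_dual_def)

lemma unbounded_geometric: "\<exists>k. (4/3::real) ^ k / 4 > c"
  using real_arch_pow[of "4/3::real" "4 * c"] by (auto simp: field_simps)

text \<open>Mackey's theorem. The functionals of the gliding hump lie in the polar of a neighbourhood,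
  so the resulting series is again continuous.\<close>

lemma weakly_bounded_absorbed:
  fixes B :: "'a::locally_convex_space set"
  assumes wb: "\<And>\<phi>. \<phi> \<in> top_dual \<Longrightarrow> \<exists>c. \<forall>x\<in>B. \<bar>\<phi> x\<bar> \<le> c" and U: "open U" "0 \<in> U"
  obtains r where "r > 0" "\<And>x c. x \<in> B \<Longrightarrow> \<bar>c\<bar> \<le> r \<Longrightarrow> c *\<^sub>R x \<in> U"
proof -
  obtain V where V: "open V" "0 \<in> V" "V \<subseteq> U" "convex V" "\<And>x. x \<in> V \<Longrightarrow> - x \<in> V"
    using convex_symmetric_neighbourhood[OF U] by blast
  \<comment> \<open>\<open>D\<close> is the absolute polar of \<open>V\<close>. It is bounded at
    each point since \<open>V\<close> is absorbing.\<close>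
  define D where "D = {\<psi> \<in> top_dual. \<forall>v\<in>V. \<bar>\<psi> v\<bar> \<le> 1}"
  have bddD: "\<exists>c. \<forall>\<psi>\<in>D. \<bar>\<psi> x\<bar> \<le> c" for x
  proof -
    obtain t where t: "t > 0" "t *\<^sub>R x \<in> V" using lcs_absorbing[OF V(1,2)] by blast
    have "\<bar>\<psi> x\<bar> \<le> 1 / t" if "\<psi> \<in> D" for \<psi>
    proof -
      have "\<bar>\<psi> (t *\<^sub>R x)\<bar> \<le> 1" "linear \<psi>" using that t by (auto simp: D_def top_dual_def)
      then show ?thesis using t(1) by (simp add: linear_scale abs_mult field_simps)
    qed
    then show ?thesis by blast
  qed
  have "\<exists>r>0. \<forall>x\<in>B. r *\<^sub>R x \<in> V"
  proof (rule ccontr)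
    assume neg: "\<not> ?thesis"
    \<comment> \<open>If no multiple of \<open>B\<close> fits into \<open>V\<close>, then separating
      \<open>(1 / M) *\<^sub>R x\<close> from \<open>V\<close> gives an element of the polar that is
      at least \<open>M\<close> at \<open>x\<close>.\<close>
    have "\<exists>x\<in>B. \<exists>\<psi>\<in>D. \<bar>\<psi> x\<bar> > N" for N
    proof -
      define M where "M = \<bar>N\<bar> + 1"
      have M: "M > 0" "M > N" by (auto simp: M_def)
      then obtain x where x: "x \<in> B" "(1 / M) *\<^sub>R x \<notin> V" using neg by (meson divide_pos_pos zero_less_one)
      obtain \<psi> where \<psi>: "\<psi> \<in> top_dual" "\<And>y. y \<in> V \<Longrightarrow> \<psi> y \<le> 1" "\<psi> ((1 / M) *\<^sub>R x) \<ge> 1"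
        using separation_from_convex_neighbourhood[OF V(4,1,2) order_refl x(2)] by blast
      have lin: "linear \<psi>" by (rule top_dualD(1)[OF \<psi>(1)])
      have "\<psi> \<in> D"
        using \<psi>(1,2) V(5) linear_neg[OF lin] by (fastforce simp: D_def abs_le_iff)
      moreover have "\<psi> x \<ge> M" using \<psi>(3) M by (simp add: linear_scale[OF lin] field_simps)
      ultimately show ?thesis using x(1) M by (intro bexI[of _ x] bexI[of _ \<psi>]) auto
    qed
    note unb = this
    obtain x f and s :: "nat \<Rightarrow> real"
      where xfs: "\<And>k. x k \<in> B" "\<And>k. f k \<in> D" "\<And>k. \<bar>s k\<bar> = 1"
        "\<And>k. \<bar>\<Sum>j. s j * (1/3) ^ j * f j (x k)\<bar> \<ge> (4/3) ^ k / 4"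
      by (rule gliding_hump[where b = "\<lambda>x \<psi>. \<psi> x" and A = B and D = D, OF bddD unb]) (rule that)
    define \<phi> where "\<phi> = (\<lambda>y. \<Sum>j. s j * (1/3) ^ j * f j y)"
    have lin: "linear (f j)" for j using xfs(2)[of j] by (simp add: D_def top_dual_def)
    have summ: "summable (\<lambda>j. s j * (1/3) ^ j * f j y)" for y
    proof -
      obtain c where c: "\<And>\<psi>. \<psi> \<in> D \<Longrightarrow> \<bar>\<psi> y\<bar> \<le> c" using bddD by blast
      show ?thesis
      proof (rule summable_comparison_test'[of "\<lambda>j. c * (1/3) ^ j" 0])
        show "norm (s j * (1/3) ^ j * f j y) \<le> c * (1/3) ^ j" for j
          using c[OF xfs(2)[of j]] xfs(3)[of j] by (simp add: abs_mult mult.commute mult_left_mono)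
      qed (auto intro!: summable_mult)
    qed
    have lin\<phi>: "linear \<phi>"
    proof (rule linearI)
      fix y z and c :: real
      show "\<phi> (y + z) = \<phi> y + \<phi> z"
        unfolding \<phi>_def by (subst suminf_add[OF summ summ]) (simp add: linear_add[OF lin] distrib_left)
      have "\<phi> (c *\<^sub>R y) = (\<Sum>j. c * (s j * (1/3) ^ j * f j y))"
        unfolding \<phi>_def by (simp add: linear_scale[OF lin] mult.assoc mult.left_commute)
      also have "\<dots> = c * \<phi> y" unfolding \<phi>_def by (rule suminf_mult[OF summ])
      finally show "\<phi> (c *\<^sub>R y) = c *\<^sub>R \<phi> y" by simp
    qed
    \<comment> \<open>The weights sum to 3/2. The bound 2 is halved below to match the criterion for
      continuity.\<close>
    have "\<phi> y \<le> 2" if "y \<in> V" for y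
    proof -
      have sm: "(\<lambda>j. (1/3) ^ j) sums (1 / (1 - 1/3 :: real))" by (rule geometric_sums) simp
      have "\<phi> y \<le> (\<Sum>j. (1/3) ^ j)"
        unfolding \<phi>_def
      proof (rule suminf_le[OF _ summ sums_summable[OF sm]])
        fix j
        have "\<bar>f j y\<bar> \<le> 1" using xfs(2)[of j] that by (simp add: D_def)
        then have "\<bar>s j * (1/3) ^ j * f j y\<bar> \<le> (1/3) ^ j" using xfs(3)[of j] by (simp add: abs_mult)
        then show "s j * (1/3) ^ j * f j y \<le> (1/3) ^ j" by linarith
      qed
      then show ?thesis using sums_unique[OF sm] by simp
    qed
    moreover have "linear (\<lambda>y. \<phi> y / 2)"
      using lin\<phi> by (auto simp: linear_iff add_divide_distrib)
    ultimately have "continuous_on UNIV (\<lambda>y. \<phi> y / 2)"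
      by (intro linear_le_1_imp_continuous[OF _ V(1,2)]) auto
    from continuous_on_mult_left[OF this, of 2] have "\<phi> \<in> top_dual"
      using lin\<phi> by (simp add: top_dual_def)
    then obtain c where "\<And>x. x \<in> B \<Longrightarrow> \<bar>\<phi> x\<bar> \<le> c" using wb by blast
    then have "(4/3) ^ k / 4 \<le> c" for k using xfs(1,4) order_trans unfolding \<phi>_def by blast
    then show False using unbounded_geometric[of c] by (meson not_le)
  qed
  then obtain r where r: "r > 0" "\<And>x. x \<in> B \<Longrightarrow> r *\<^sub>R x \<in> V" by blast
  have "c *\<^sub>R x \<in> U" if "x \<in> B" "\<bar>c\<bar> \<le> r" for x c
    using convex_symmetric_scale[OF V(4,2,5) r(2)[OF that(1)], of "c / r"] that r(1) V(3) by auto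
  then show ?thesis using that r(1) by blast
qed

section \<open>Weak integrals\<close>

text \<open>A compact set need not be sequentially compact here, so a cluster point of
  \<open>R\<close> is taken by filters. Along a filter finer than the image of the sequence each
  functional still has its unique limit \<open>L \<phi>\<close>, which must be its value at the
  cluster point.\<close>

lemma weak_limit_in_compact:
  fixes R :: "nat \<Rightarrow> 'a::locally_convex_space"
  assumes "compact C" "\<And>n. R n \<in> C" "\<And>\<phi>. \<phi> \<in> top_dual \<Longrightarrow> (\<lambda>n. \<phi> (R n)) \<longlonglongrightarrow> L \<phi>"
  obtains y where "y \<in> C" "\<And>\<phi>. \<phi> \<in> top_dual \<Longrightarrow> \<phi> y = L \<phi>"
proof -
  let ?F = "filtermap R sequentially"
  have "?F \<noteq> bot" "eventually (\<lambda>x. x \<in> C) ?F"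
    using assms(2) by (auto simp: eventually_filtermap filtermap_bot_iff)
  then obtain y where y: "y \<in> C" "inf (nhds y) ?F \<noteq> bot"
    using assms(1) unfolding compact_filter by blast
  have "\<phi> y = L \<phi>" if \<phi>: "\<phi> \<in> top_dual" for \<phi>
  proof (rule tendsto_unique[OF y(2)])
    have "(\<phi> \<longlongrightarrow> \<phi> y) (nhds y)"
      using top_dualD(3)[OF \<phi>, of "\<lambda>x. x" y "nhds y"] by (simp add: filterlim_ident)
    then show "(\<phi> \<longlongrightarrow> \<phi> y) (inf (nhds y) ?F)" by (rule tendsto_mono[rotated]) simp
    have "(\<phi> \<longlongrightarrow> L \<phi>) ?F" using assms(3)[OF \<phi>] by (simp add: filterlim_filtermap)
    then show "(\<phi> \<longlongrightarrow> L \<phi>) (inf (nhds y) ?F)" by (rule tendsto_mono[rotated]) simp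
  qed
  then show ?thesis using that y(1) by blast
qed

lemma compact_convergent_sequence:
  fixes f :: "nat \<Rightarrow> 'a::topological_space"
  assumes "f \<longlonglongrightarrow> l"
  shows "compact (insert l (range f))"
proof (rule compactI)
  fix \<C> assume C: "\<forall>t\<in>\<C>. open t" "insert l (range f) \<subseteq> \<Union>\<C>"
  then obtain W where W: "W \<in> \<C>" "l \<in> W" by auto
  then have "eventually (\<lambda>n. f n \<in> W) sequentially"
    using C(1) assms by (auto dest: topological_tendstoD)
  then obtain N where N: "\<And>n. n \<ge> N \<Longrightarrow> f n \<in> W" by (auto simp: eventually_sequentially)
  have "\<forall>n. \<exists>t. t \<in> \<C> \<and> f n \<in> t" using C(2) by blast
  then obtain g where g: "\<And>n. g n \<in> \<C>" "\<And>n. f n \<in> g n" by metis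
  have cover: "f n \<in> \<Union>(insert W (g ` {..<N}))" for n
    using N[of n] g(2)[of n] by (cases "n < N") auto
  then show "\<exists>\<C>'\<subseteq>\<C>. finite \<C>' \<and> insert l (range f) \<subseteq> \<Union>\<C>'"
    using W g(1) cover by (intro exI[of _ "insert W (g ` {..<N})"]) auto
qed

text \<open>Countably many separating functions embed \<open>K\<close> continuously and injectively
  into a countable product of real lines; on a compact set this is a homeomorphism onto the image.
  The result supplies the metrizability demanded by \<open>compact_convex_closures\<close>.\<close>

lemma metrizable_if_countably_separated:
  fixes K :: "'a::topological_space set" and D :: "('a \<Rightarrow> real) set"
  assumes "compact K" "countable D" "\<And>f. f \<in> D \<Longrightarrow> continuous_on K f"
    and sep: "\<And>x y. x \<in> K \<Longrightarrow> y \<in> K \<Longrightarrow> x \<noteq> y \<Longrightarrow> \<exists>f\<in>D. f x \<noteq> f y"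
  shows "metrizable_space (top_of_set K)"
proof -
  \<comment> \<open>The zero function is added only so that \<open>from_nat_into\<close> enumerates
    a nonempty set.\<close>
  define E where "E = insert (\<lambda>_. 0) D"
  have E: "countable E" "E \<noteq> {}" "\<And>f. f \<in> E \<Longrightarrow> continuous_on K f"
    using assms by (auto simp: E_def)
  define e where "e = (\<lambda>x n. from_nat_into E n x)"
  have "continuous_on K e"
    by (rule continuous_on_coordinatewise_then_product)
      (use E(3)[OF from_nat_into[OF E(2)]] in \<open>simp add: e_def\<close>)
  moreover have "inj_on e K"
  proof (rule inj_onI, rule ccontr)
    fix x y assume xy: "x \<in> K" "y \<in> K" "e x = e y" "x \<noteq> y"
    then obtain f where f: "f \<in> E" "f x \<noteq> f y" using sep by (auto simp: E_def)
    obtain n where "from_nat_into E n = f" using from_nat_into_surj[OF E(1) f(1)] by blast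
    then show False using f(2) fun_cong[OF xy(3), of n] by (simp add: e_def)
  qed
  ultimately obtain h where "homeomorphism K (e ` K) e h"
    using homeomorphism_compact[OF assms(1)] by blast
  then have "homeomorphic_maps (top_of_set K) (top_of_set (e ` K)) e h"
    by (force simp: homeomorphic_maps_def homeomorphism_def Pi_iff)
  then have "top_of_set K homeomorphic_space top_of_set (e ` K)"
    by (auto simp: homeomorphic_space_def)
  moreover have "metrizable_space (top_of_set (e ` K))"
    by (intro metrizable_space_subtopology metrizable_space_euclidean)
  ultimately show ?thesis by (simp add: homeomorphic_metrizable_space)
qed

text \<open>The dual need not contain a countable separating family for the whole space. For a
  curve, one functional is chosen for each pair of basic open parameter sets whose images some
  functional strictly orders; a countable base leaves countably many choices, and continuity
  provides such a pair for any two distinct points.\<close>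

lemma metrizable_curve:
  fixes \<gamma> :: "'b::second_countable_topology \<Rightarrow> 'a::locally_convex_space"
  assumes S: "compact S" "continuous_on S \<gamma>"
    and sep: "\<And>x y::'a. x \<noteq> y \<Longrightarrow> \<exists>\<phi>\<in>top_dual. \<phi> x \<noteq> \<phi> y"
  shows "metrizable_space (top_of_set (\<gamma> ` S))"
proof -
  obtain B :: "'b set set" where B: "countable B" "topological_basis B"
    using ex_countable_basis by blast
  define Q where "Q = (\<lambda>(U, V) \<phi>. \<phi> \<in> top_dual \<and> (\<forall>u\<in>U \<inter> S. \<forall>v\<in>V \<inter> S. \<phi> (\<gamma> u) < \<phi> (\<gamma> v)))"
  define D where "D = (\<lambda>p. SOME \<phi>. Q p \<phi>) ` {p \<in> B \<times> B. \<exists>\<phi>. Q p \<phi>}"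
  have nbhd: "\<exists>U\<in>B. s \<in> U \<and> (\<forall>u\<in>U \<inter> S. f (\<gamma> u) < c)"
    if "f \<in> top_dual" "s \<in> S" "f (\<gamma> s) < c" for f s and c :: real
  proof -
    have "continuous_on S (\<lambda>u. f (\<gamma> u))"
      using continuous_on_compose[OF S(2) top_dualD(2)[OF that(1)]] by (simp add: o_def)
    then obtain W where W: "open W" "W \<inter> S = (\<lambda>u. f (\<gamma> u)) -` {..<c} \<inter> S"
      unfolding continuous_on_open_invariant by (meson open_lessThan)
    have "s \<in> W" using W(2) that by auto
    then obtain U where "U \<in> B" "s \<in> U" "U \<subseteq> W" using topological_basisE[OF B(2) W(1)] by metis
    then show ?thesis using W(2) by (intro bexI[of _ U]) auto
  qed
  have strict: "\<exists>f\<in>D. f (\<gamma> s) < f (\<gamma> t)"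
    if st: "s \<in> S" "t \<in> S" and \<phi>: "\<phi> \<in> top_dual" "\<phi> (\<gamma> s) < \<phi> (\<gamma> t)" for s t \<phi>
  proof -
    define c where "c = (\<phi> (\<gamma> s) + \<phi> (\<gamma> t)) / 2"
    have c: "\<phi> (\<gamma> s) < c" "- \<phi> (\<gamma> t) < - c" using \<phi>(2) by (auto simp: c_def)
    have "(\<lambda>x. - \<phi> x) \<in> top_dual"
      using \<phi>(1) by (auto simp: top_dual_def linear_iff intro!: continuous_intros)
    then obtain V where V: "V \<in> B" "t \<in> V" "\<forall>v\<in>V \<inter> S. - \<phi> (\<gamma> v) < - c"
      using nbhd[of "\<lambda>x. - \<phi> x" t "- c"] st c by blast
    obtain U where U: "U \<in> B" "s \<in> U" "\<forall>u\<in>U \<inter> S. \<phi> (\<gamma> u) < c"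
      using nbhd[OF \<phi>(1) st(1) c(1)] by blast
    have ex: "Q (U, V) \<phi>" using U(3) V(3) \<phi>(1) by (force simp: Q_def)
    define f where "f = (SOME \<phi>. Q (U, V) \<phi>)"
    have "Q (U, V) f" unfolding f_def by (rule someI[of "Q (U, V)", OF ex])
    moreover have "f \<in> D" unfolding D_def f_def using ex U(1) V(1) by blast
    ultimately show ?thesis using U(2) V(2) st by (auto simp: Q_def)
  qed
  show ?thesis
  proof (rule metrizable_if_countably_separated)
    show "compact (\<gamma> ` S)" by (rule compact_continuous_image[OF S(2,1)])
    show "countable D" unfolding D_def using B(1) by (auto intro: countable_subset)
    show "continuous_on (\<gamma> ` S) f" if fD: "f \<in> D" for f
    proof -
      obtain p where p: "f = (SOME \<phi>. Q p \<phi>)" "p \<in> {p \<in> B \<times> B. \<exists>\<phi>. Q p \<phi>}"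
        using fD unfolding D_def by (rule imageE)
      then have ex: "\<exists>\<phi>. Q p \<phi>" by blast
      have "Q p f" unfolding p(1) by (rule someI_ex[OF ex])
      then have "f \<in> top_dual" by (cases p) (simp add: Q_def)
      then show ?thesis by (rule top_dualD(2))
    qed
    show "\<exists>f\<in>D. f x \<noteq> f y" if xy: "x \<in> \<gamma> ` S" "y \<in> \<gamma> ` S" "x \<noteq> y" for x y
    proof -
      obtain \<phi> where "\<phi> \<in> top_dual" "\<phi> x \<noteq> \<phi> y" using sep[OF xy(3)] by blast
      then show ?thesis
        using xy(1,2) strict by (metis (no_types, lifting) imageE less_irrefl linorder_neqE_linordered_idom)
    qed
  qed
qed

text \<open>The equal weights \<open>1 / Suc n\<close> sum to 1, so the corresponding sums of
  vectors are convex combinations of points of a curve; this normalisation explains the division by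
  \<open>b - a\<close>.\<close>

lemma riemann_sum_tendsto:
  fixes g :: "real \<Rightarrow> real"
  assumes g: "continuous_on {a..b} g" and ab: "a < b"
  shows "(\<lambda>n. \<Sum>k<Suc n. (1 / Suc n) * g (a + k * ((b - a) / Suc n)))
    \<longlonglongrightarrow> integral {a..b} g / (b - a)"
proof (rule LIMSEQ_I)
  fix e :: real assume "e > 0"
  then have e: "e / 2 > 0" by simp
  obtain d where d: "d > 0" "\<And>x y. x \<in> {a..b} \<Longrightarrow> y \<in> {a..b} \<Longrightarrow> \<bar>y - x\<bar> < d \<Longrightarrow> \<bar>g y - g x\<bar> < e / 2"
    using compact_uniformly_continuous[OF g compact_Icc] e
    unfolding uniformly_continuous_on_def dist_real_def by metis
  obtain N :: nat where N: "N > (b - a) / d" using reals_Archimedean2 by blast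
  show "\<exists>no. \<forall>n\<ge>no. norm ((\<Sum>k<Suc n. (1 / Suc n) * g (a + k * ((b - a) / Suc n)))
      - integral {a..b} g / (b - a)) < e"
  proof (intro exI allI impI)
    fix n assume n: "n \<ge> N"
    define h where "h = (b - a) / Suc n"
    have h: "h > 0" "Suc n * h = b - a" using ab by (auto simp: h_def)
    have "Suc n * d > b - a" using N n d(1) ab by (simp add: field_simps) (smt (verit) mult_left_mono of_nat_mono)
    then have hd: "h < d" by (simp add: h_def field_simps)
    have le_b: "a + real m * h \<le> b" if "m \<le> Suc n" for m
    proof -
      have "real m * h \<le> real (Suc n) * h" using that h(1) by (intro mult_right_mono) auto
      then show ?thesis using h(2) by linarith
    qed
    \<comment> \<open>Induction over the subintervals accumulates the error: uniform continuity
      allows \<open>h * (e / 2)\<close> on each of them.\<close>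
    have part: "\<bar>(\<Sum>k<m. h * g (a + real k * h)) - integral {a..a + real m * h} g\<bar> \<le> real m * h * (e / 2)"
      if "m \<le> Suc n" for m :: nat
      using that
    proof (induction m)
      case (Suc m)
      define p q where "p = a + real m * h" and "q = a + real (Suc m) * h"
      have pq: "a \<le> p" "p \<le> q" "q \<le> b" "q - p = h"
        using le_b[OF Suc.prems] h(1) by (auto simp: p_def q_def algebra_simps)
      have cont: "continuous_on {p..q} g" using continuous_on_subset[OF g] pq by auto
      have int: "g integrable_on {a..q}"
        using continuous_on_subset[OF g] pq by (intro integrable_continuous_interval) auto
      have split: "integral {a..q} g = integral {a..p} g + integral {p..q} g"
        using Henstock_Kurzweil_Integration.integral_combine[OF pq(1,2) int] by simp
      have "norm (integral {p..q} (\<lambda>t. g p - g t)) \<le> e / 2 * (q - p)"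
      proof (rule Henstock_Kurzweil_Integration.integral_bound[OF pq(2)])
        show "continuous_on {p..q} (\<lambda>t. g p - g t)" by (intro continuous_intros cont)
        show "norm (g p - g t) \<le> e / 2" if "t \<in> {p..q}" for t
        proof -
          have "\<bar>g p - g t\<bar> < e / 2" by (rule d(2)) (use that pq hd in auto)
          then show ?thesis by simp
        qed
      qed
      moreover have "integral {p..q} (\<lambda>t. g p - g t) = h * g p - integral {p..q} g"
        using Henstock_Kurzweil_Integration.integral_diff[OF integrable_const_ivl[of "g p" p q]
            integrable_continuous_interval[OF cont]] pq by simp
      ultimately have "\<bar>h * g p - integral {p..q} g\<bar> \<le> h * (e / 2)" using pq(4) by (simp add: mult.commute)
      moreover have "\<bar>(\<Sum>k<m. h * g (a + real k * h)) - integral {a..p} g\<bar> \<le> real m * h * (e / 2)"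
        using Suc unfolding p_def by simp
      moreover have "real (Suc m) * h * (e / 2) = m * h * (e / 2) + h * (e / 2)" by (simp add: algebra_simps)
      ultimately show ?case
        using split unfolding q_def[symmetric] by (simp add: p_def[symmetric] abs_if split: if_splits)
    qed simp
    have "(\<Sum>k<Suc n. (1 / Suc n) * g (a + k * ((b - a) / Suc n))) = (\<Sum>k<Suc n. h * g (a + k * h)) / (b - a)"
    proof -
      have "1 / real (Suc n) = h / (b - a)" using ab by (simp add: h_def)
      then show ?thesis unfolding h_def[symmetric] sum_divide_distrib by simp
    qed
    moreover have "\<bar>(\<Sum>k<Suc n. h * g (a + k * h)) - integral {a..b} g\<bar> \<le> (b - a) * (e / 2)"
      using part[of "Suc n"] h(2) by simp
    then have "\<bar>((\<Sum>k<Suc n. h * g (a + k * h)) - integral {a..b} g) / (b - a)\<bar> \<le> e / 2"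
      using ab by (simp add: abs_divide pos_divide_le_eq mult.commute del: sum.lessThan_Suc)
    ultimately have "\<bar>(\<Sum>k<Suc n. (1 / Suc n) * g (a + k * ((b - a) / Suc n))) - integral {a..b} g / (b - a)\<bar> \<le> e / 2"
      by (simp only: diff_divide_distrib)
    then show "norm ((\<Sum>k<Suc n. (1 / Suc n) * g (a + k * ((b - a) / Suc n))) - integral {a..b} g / (b - a)) < e"
      using e by simp
  qed
qed

section \<open>Norming dual pairs\<close>

text \<open>On a set that is not bounded above the supremum in the reals is an unspecified value,
  but it is always the same one.\<close>

lemma Sup_real_unbounded:
  fixes A B :: "real set"
  assumes "\<not> bdd_above A" "\<not> bdd_above B"
  shows "Sup A = Sup B"
proof -
  have "(\<lambda>z. \<forall>x\<in>S. x \<le> z) = (\<lambda>_. False)" if "\<not> bdd_above S" for S :: "real set"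
    by (intro ext) (use that in \<open>auto simp: bdd_above_def\<close>)
  then show ?thesis using assms by (simp add: Sup_real_def)
qed

locale norming_pair =
  fixes \<pi> :: "'a::locally_convex_space \<Rightarrow> real"
  assumes pair: "norming_dual_pair \<pi>" and cc: "compact_convex_closures TYPE('a)"
begin

lemma pi_add: "\<pi> (x + y) \<le> \<pi> x + \<pi> y" and pi_scale: "\<pi> (c *\<^sub>R x) = \<bar>c\<bar> * \<pi> x"
  and pi_eq_0: "\<pi> x = 0 \<Longrightarrow> x = 0"
  and pi_mcomplete: "Metric_space.mcomplete UNIV (\<lambda>x y. \<pi> (x - y))"
  using pair by (auto simp: norming_dual_pair_def banach_norm_def seminorm_def)

lemma pi_zero [simp]: "\<pi> 0 = 0"
  using pi_scale[of 0 0] by simp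

lemma pi_minus [simp]: "\<pi> (- x) = \<pi> x"
  using pi_scale[of "-1" x] by simp

lemma pi_minus_commute: "\<pi> (x - y) = \<pi> (y - x)"
  using pi_minus[of "x - y"] by simp

lemma pi_nonneg: "0 \<le> \<pi> x"
  using pi_add[of x "- x"] by simp

lemma pi_metric: "Metric_space UNIV (\<lambda>x y. \<pi> (x - y))"
proof
  show "\<pi> (x - z) \<le> \<pi> (x - y) + \<pi> (y - z)" for x y z
    using pi_add[of "x - y" "y - z"] by simp
  show "(\<pi> (x - y) = 0) = (x = y)" for x y using pi_eq_0[of "x - y"] by auto
qed (use pi_nonneg pi_minus_commute in auto)

lemma norm_dual_bdd:
  assumes "\<phi> \<in> norm_dual \<pi>"
  shows "bdd_above ((\<lambda>x. \<bar>\<phi> x\<bar>) ` {x. \<pi> x \<le> 1})"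
proof -
  obtain C where C: "\<And>x. \<bar>\<phi> x\<bar> \<le> C * \<pi> x" using assms by (auto simp: norm_dual_def)
  show ?thesis
  proof (rule bdd_aboveI2)
    fix x assume x: "x \<in> {x. \<pi> x \<le> 1}"
    have "C * \<pi> x \<le> \<bar>C\<bar> * \<pi> x" using pi_nonneg[of x] by (intro mult_right_mono) auto
    also have "\<dots> \<le> \<bar>C\<bar> * 1" using x by (intro mult_left_mono) auto
    finally show "\<bar>\<phi> x\<bar> \<le> \<bar>C\<bar>" using C[of x] by simp
  qed
qed

lemma linear_le_unit_ball:
  assumes \<phi>: "linear \<phi>" and C: "\<And>x. \<pi> x \<le> 1 \<Longrightarrow> \<bar>\<phi> x\<bar> \<le> C"
  shows "\<bar>\<phi> x\<bar> \<le> C * \<pi> x"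
proof (cases "\<pi> x = 0")
  case True
  then show ?thesis using linear_0[OF \<phi>] pi_eq_0[OF True] by simp
next
  case False
  then have pos: "\<pi> x > 0" using pi_nonneg[of x] by simp
  have "\<bar>\<phi> ((1 / \<pi> x) *\<^sub>R x)\<bar> \<le> C" using pos by (intro C) (simp add: pi_scale)
  then show ?thesis using pos by (simp add: linear_scale[OF \<phi>] abs_mult field_simps)
qed

lemma norm_dual_iff_bdd:
  "\<phi> \<in> norm_dual \<pi> \<longleftrightarrow> linear \<phi> \<and> bdd_above ((\<lambda>x. \<bar>\<phi> x\<bar>) ` {x. \<pi> x \<le> 1})"
proof
  assume "linear \<phi> \<and> bdd_above ((\<lambda>x. \<bar>\<phi> x\<bar>) ` {x. \<pi> x \<le> 1})"
  then obtain C where "linear \<phi>" "\<And>x. \<pi> x \<le> 1 \<Longrightarrow> \<bar>\<phi> x\<bar> \<le> C" by (auto simp: bdd_above_def)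
  then show "\<phi> \<in> norm_dual \<pi>" using linear_le_unit_ball[of \<phi> C] by (auto simp: norm_dual_def)
qed (use norm_dual_bdd in \<open>auto simp: norm_dual_def\<close>)

lemma dual_norm_bound:
  assumes "\<phi> \<in> norm_dual \<pi>"
  shows "\<bar>\<phi> x\<bar> \<le> dual_norm \<pi> \<phi> * \<pi> x"
proof (rule linear_le_unit_ball)
  show "linear \<phi>" using assms by (simp add: norm_dual_def)
  show "\<bar>\<phi> y\<bar> \<le> dual_norm \<pi> \<phi>" if "\<pi> y \<le> 1" for y
    unfolding dual_norm_def by (rule cSUP_upper[OF _ norm_dual_bdd[OF assms]]) (use that in simp)
qed

lemma dual_norm_le:
  assumes "\<And>x. \<bar>\<phi> x\<bar> \<le> c * \<pi> x" "0 \<le> c"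
  shows "dual_norm \<pi> \<phi> \<le> c"
  unfolding dual_norm_def
proof (rule cSUP_least)
  have "\<pi> 0 \<le> 1" by simp
  then show "{x. \<pi> x \<le> 1} \<noteq> {}" by blast
  fix x assume "x \<in> {x. \<pi> x \<le> 1}"
  then have "c * \<pi> x \<le> c * 1" using assms(2) by (intro mult_left_mono) auto
  then show "\<bar>\<phi> x\<bar> \<le> c" using assms(1)[of x] by simp
qed

lemma dual_norm_nonneg:
  assumes "bdd_above ((\<lambda>x. \<bar>\<phi> x\<bar>) ` {x. \<pi> x \<le> 1})"
  shows "0 \<le> dual_norm \<pi> \<phi>"
proof -
  have "\<bar>\<phi> 0\<bar> \<le> dual_norm \<pi> \<phi>"
    unfolding dual_norm_def by (rule cSUP_upper[OF _ assms]) simp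
  then show ?thesis by linarith
qed

lemma norm_dual_diff:
  assumes "\<phi> \<in> norm_dual \<pi>" "\<psi> \<in> norm_dual \<pi>"
  shows "(\<lambda>x. \<phi> x - \<psi> x) \<in> norm_dual \<pi>"
proof -
  have le: "\<bar>\<phi> x - \<psi> x\<bar> \<le> (dual_norm \<pi> \<phi> + dual_norm \<pi> \<psi>) * \<pi> x" for x
    using dual_norm_bound[OF assms(1), of x] dual_norm_bound[OF assms(2), of x]
    by (simp add: distrib_right)
  have "linear (\<lambda>x. \<phi> x - \<psi> x)" using assms by (auto simp: norm_dual_def intro: linear_compose_sub)
  then show "(\<lambda>x. \<phi> x - \<psi> x) \<in> norm_dual \<pi>" using le by (auto simp: norm_dual_def)
qed

lemma pi_eq_SUP: "\<pi> x = (SUP \<phi>\<in>{\<phi> \<in> top_dual. dual_norm \<pi> \<phi> \<le> 1}. \<bar>\<phi> x\<bar>)"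
  using pair unfolding norming_dual_pair_def by blast

text \<open>The dual norm takes an unspecified value on unbounded functionals. If that value is
  nonnegative, the distance of the dual norm is a metric and the claim is part of the closedness
  of the dual in the Banach dual. Otherwise all multiples of an unbounded functional would occur
  in the supremum of \<open>pi_eq_SUP\<close>, which would then take that same negative value.\<close>

lemma top_dual_subset_norm_dual: "top_dual \<subseteq> norm_dual \<pi>"
\<comment> \<open>The carrier of \<open>mtopology\<close> is known only once the metric axioms hold,
  hence this case distinction.\<close>
proof (cases "Metric_space (norm_dual \<pi>) (\<lambda>\<phi> \<psi>. dual_norm \<pi> (\<lambda>x. \<phi> x - \<psi> x))")
  case True
  have "closedin (Metric_space.mtopology (norm_dual \<pi>) (\<lambda>\<phi> \<psi>. dual_norm \<pi> (\<lambda>x. \<phi> x - \<psi> x))) top_dual"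
    using pair by (simp add: norming_dual_pair_def)
  then show ?thesis using closedin_subset Metric_space.topspace_mtopology[OF True] by metis
next
  case False
  have "\<exists>\<phi> \<psi>. dual_norm \<pi> (\<lambda>x. \<phi> x - \<psi> x) < 0"
  proof (rule ccontr)
    assume neg: "\<nexists>\<phi> \<psi>. dual_norm \<pi> (\<lambda>x. \<phi> x - \<psi> x) < 0"
    have "Metric_space (norm_dual \<pi>) (\<lambda>\<phi> \<psi>. dual_norm \<pi> (\<lambda>x. \<phi> x - \<psi> x))"
    proof
      show "0 \<le> dual_norm \<pi> (\<lambda>x. \<phi> x - \<psi> x)" for \<phi> \<psi> using neg by (meson not_le)
      show "dual_norm \<pi> (\<lambda>x. \<phi> x - \<psi> x) = dual_norm \<pi> (\<lambda>x. \<psi> x - \<phi> x)" for \<phi> \<psi>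
        by (simp add: dual_norm_def abs_minus_commute)
      show "(dual_norm \<pi> (\<lambda>x. \<phi> x - \<psi> x) = 0) = (\<phi> = \<psi>)"
        if "\<phi> \<in> norm_dual \<pi>" "\<psi> \<in> norm_dual \<pi>" for \<phi> \<psi>
      proof
        assume "dual_norm \<pi> (\<lambda>x. \<phi> x - \<psi> x) = 0"
        then show "\<phi> = \<psi>" using dual_norm_bound[OF norm_dual_diff[OF that]] by (simp add: fun_eq_iff)
      next
        assume "\<phi> = \<psi>"
        then have "dual_norm \<pi> (\<lambda>x. \<phi> x - \<psi> x) \<le> 0" by (intro dual_norm_le) auto
        then show "dual_norm \<pi> (\<lambda>x. \<phi> x - \<psi> x) = 0" using neg by (meson less_le)
      qed
      show "dual_norm \<pi> (\<lambda>x. \<phi> x - \<theta> x) \<le> dual_norm \<pi> (\<lambda>x. \<phi> x - \<psi> x) + dual_norm \<pi> (\<lambda>x. \<psi> x - \<theta> x)"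
        if "\<phi> \<in> norm_dual \<pi>" "\<psi> \<in> norm_dual \<pi>" "\<theta> \<in> norm_dual \<pi>" for \<phi> \<psi> \<theta>
      proof (rule dual_norm_le)
        show "0 \<le> dual_norm \<pi> (\<lambda>x. \<phi> x - \<psi> x) + dual_norm \<pi> (\<lambda>x. \<psi> x - \<theta> x)"
          using neg by (meson add_nonneg_nonneg not_le)
        fix x
        show "\<bar>\<phi> x - \<theta> x\<bar> \<le> (dual_norm \<pi> (\<lambda>x. \<phi> x - \<psi> x) + dual_norm \<pi> (\<lambda>x. \<psi> x - \<theta> x)) * \<pi> x"
          using dual_norm_bound[OF norm_dual_diff[OF that(1,2)], of x]
            dual_norm_bound[OF norm_dual_diff[OF that(2,3)], of x]
          by (simp add: distrib_right)
      qed
    qed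
    then show False using False by blast
  qed
  then obtain \<psi> where \<psi>: "dual_norm \<pi> \<psi> < 0" by blast
  let ?ball = "{x. \<pi> x \<le> 1}"
  have unb\<psi>: "\<not> bdd_above ((\<lambda>x. \<bar>\<psi> x\<bar>) ` ?ball)" using dual_norm_nonneg[of \<psi>] \<psi> by linarith
  show ?thesis
  proof (rule subsetI, rule ccontr)
    fix \<phi> assume \<phi>: "\<phi> \<in> top_dual" "\<phi> \<notin> norm_dual \<pi>"
    have lin: "linear \<phi>" using \<phi>(1) by (simp add: top_dual_def)
    have mult: "(\<lambda>x. c * \<phi> x) \<in> top_dual \<and> dual_norm \<pi> (\<lambda>x. c * \<phi> x) \<le> 1" if c: "c > 0" for c
    proof -
      have l: "linear (\<lambda>x. c * \<phi> x)" using lin by (auto simp: linear_iff algebra_simps)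
      have "(\<lambda>x. c * \<phi> x) \<notin> norm_dual \<pi>"
      proof
        assume "(\<lambda>x. c * \<phi> x) \<in> norm_dual \<pi>"
        then obtain C where C: "\<And>x. \<bar>c * \<phi> x\<bar> \<le> C * \<pi> x" by (auto simp: norm_dual_def)
        have "\<bar>\<phi> x\<bar> \<le> C / c * \<pi> x" for x using C[of x] c by (simp add: abs_mult field_simps)
        then show False using \<phi>(2) lin unfolding norm_dual_def by blast
      qed
      then have "\<not> bdd_above ((\<lambda>x. \<bar>c * \<phi> x\<bar>) ` ?ball)" using l by (simp add: norm_dual_iff_bdd)
      then have "dual_norm \<pi> (\<lambda>x. c * \<phi> x) = dual_norm \<pi> \<psi>"
        unfolding dual_norm_def by (rule Sup_real_unbounded[OF _ unb\<psi>])
      then show ?thesis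
        using \<psi> l \<phi>(1) by (auto simp: top_dual_def intro!: continuous_intros)
    qed
    obtain x where x: "\<phi> x \<noteq> 0"
    proof (rule ccontr)
      assume "\<not> thesis"
      then have "\<phi> x = 0" for x using that by blast
      then have "\<bar>\<phi> x\<bar> \<le> 0 * \<pi> x" for x by simp
      then show False using \<phi>(2) lin unfolding norm_dual_def by blast
    qed
    let ?S = "(\<lambda>\<phi>. \<bar>\<phi> x\<bar>) ` {\<phi> \<in> top_dual. dual_norm \<pi> \<phi> \<le> 1}"
    have "\<not> bdd_above ?S"
    proof
      assume "bdd_above ?S"
      then obtain C where C: "\<And>\<phi>. \<phi> \<in> top_dual \<Longrightarrow> dual_norm \<pi> \<phi> \<le> 1 \<Longrightarrow> \<bar>\<phi> x\<bar> \<le> C"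
        by (auto simp: bdd_above_def)
      define c where "c = (\<bar>C\<bar> + 1) / \<bar>\<phi> x\<bar>"
      have "c > 0" using x by (simp add: c_def)
      then have "\<bar>c * \<phi> x\<bar> \<le> C" using C mult by blast
      moreover have "\<bar>c * \<phi> x\<bar> = \<bar>C\<bar> + 1" using x by (simp add: c_def abs_mult)
      ultimately show False by linarith
    qed
    then have "\<pi> x = dual_norm \<pi> \<psi>"
      unfolding pi_eq_SUP[of x] dual_norm_def[of _ \<psi>] by (rule Sup_real_unbounded[OF _ unb\<psi>])
    then show False using \<psi> pi_nonneg[of x] by simp
  qed
qed

lemma top_dual_bound: "\<phi> \<in> top_dual \<Longrightarrow> \<bar>\<phi> x\<bar> \<le> dual_norm \<pi> \<phi> * \<pi> x"
  by (rule dual_norm_bound) (rule subsetD[OF top_dual_subset_norm_dual])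

lemma top_dual_norm_nonneg: "\<phi> \<in> top_dual \<Longrightarrow> 0 \<le> dual_norm \<pi> \<phi>"
  by (rule dual_norm_nonneg[OF norm_dual_bdd]) (rule subsetD[OF top_dual_subset_norm_dual])

lemma unit_functional_le: "\<phi> \<in> top_dual \<Longrightarrow> dual_norm \<pi> \<phi> \<le> 1 \<Longrightarrow> \<bar>\<phi> x\<bar> \<le> \<pi> x"
  using top_dual_bound[of \<phi> x] mult_right_mono[of "dual_norm \<pi> \<phi>" 1 "\<pi> x"] pi_nonneg[of x] by simp

lemma zero_unit_functional: "(\<lambda>_. 0) \<in> {\<phi> \<in> top_dual. dual_norm \<pi> \<phi> \<le> 1}"
proof -
  have "dual_norm \<pi> (\<lambda>_. 0) \<le> 0" by (rule dual_norm_le) auto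
  then show ?thesis by (auto simp: top_dual_def linear_iff)
qed

lemma pi_le:
  assumes "\<And>\<phi>. \<phi> \<in> top_dual \<Longrightarrow> dual_norm \<pi> \<phi> \<le> 1 \<Longrightarrow> \<bar>\<phi> x\<bar> \<le> c"
  shows "\<pi> x \<le> c"
proof -
  have "(SUP \<phi>\<in>{\<phi> \<in> top_dual. dual_norm \<pi> \<phi> \<le> 1}. \<bar>\<phi> x\<bar>) \<le> c"
  proof (rule cSUP_least)
    show "{\<phi> \<in> top_dual. dual_norm \<pi> \<phi> \<le> 1} \<noteq> {}" using zero_unit_functional by (rule ex_in_conv[THEN iffD1, OF exI])
    show "\<bar>\<phi> x\<bar> \<le> c" if "\<phi> \<in> {\<phi> \<in> top_dual. dual_norm \<pi> \<phi> \<le> 1}" for \<phi>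
      using that assms by simp
  qed
  then show ?thesis by (simp only: pi_eq_SUP[of x])
qed

text \<open>A point on which all functionals vanish has norm 0, the norm being their supremum.
  Elements known only through their functional values are identified in this way.\<close>

lemma top_dual_separates:
  fixes x y :: 'a
  assumes "\<And>\<phi>. \<phi> \<in> top_dual \<Longrightarrow> \<phi> x = \<phi> y"
  shows "x = y"
proof -
  have "\<pi> (x - y) \<le> 0"
    by (rule pi_le) (simp add: assms linear_diff[OF top_dualD(1)])
  then show ?thesis using pi_nonneg[of "x - y"] pi_eq_0[of "x - y"] by simp
qed

section \<open>Convex compactness: weak series, uniform boundedness and weak means\<close>

text \<open>A null sequence together with its limit is compact, and metrizable because it is
  countable. The partial sums of the series stay in its convex hull, so a cluster point in the
  compact closure represents the sum.\<close>

lemma weak_series: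
  fixes z :: "nat \<Rightarrow> 'a"
  assumes z: "z \<longlonglongrightarrow> 0"
  obtains y where "\<And>\<phi>. \<phi> \<in> top_dual \<Longrightarrow> \<phi> y = (\<Sum>j. (1/2) ^ Suc j * \<phi> (z j))"
proof -
  define K where "K = insert 0 (range z)"
  have K: "compact K" unfolding K_def by (rule compact_convergent_sequence[OF z])
  define D where "D = (\<lambda>p. SOME \<phi>. \<phi> \<in> top_dual \<and> \<phi> (fst p) \<noteq> \<phi> (snd p)) ` {p \<in> K \<times> K. fst p \<noteq> snd p}"
  have D: "(SOME \<phi>. \<phi> \<in> top_dual \<and> \<phi> x \<noteq> \<phi> y) \<in> top_dual
      \<and> (SOME \<phi>. \<phi> \<in> top_dual \<and> \<phi> x \<noteq> \<phi> y) x \<noteq> (SOME \<phi>. \<phi> \<in> top_dual \<and> \<phi> x \<noteq> \<phi> y) y"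
    if "x \<noteq> y" for x y :: 'a
    by (rule someI_ex[of "\<lambda>\<phi>. \<phi> \<in> top_dual \<and> \<phi> x \<noteq> \<phi> y"])
      (use top_dual_separates[of x y] that in blast)
  have "metrizable_space (top_of_set K)"
  proof (rule metrizable_if_countably_separated[OF K])
    have "countable (K \<times> K)" by (simp add: K_def)
    then show "countable D" unfolding D_def by (auto intro: countable_subset)
    show "continuous_on K f" if "f \<in> D" for f
      using that D by (auto simp: D_def intro!: top_dualD(2))
    show "\<exists>f\<in>D. f x \<noteq> f y" if "x \<in> K" "y \<in> K" "x \<noteq> y" for x y
      using that D[OF that(3)] unfolding D_def by (intro bexI[OF _ imageI[of "(x, y)"]]) auto
  qed
  then have C: "compact (closure (convex hull K))"
    using cc K unfolding compact_convex_closures_def by blast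
  define R where "R = (\<lambda>n. \<Sum>j<n. (1/2) ^ Suc j *\<^sub>R z j)"
  have "R n \<in> convex hull K" for n
  proof -
    \<comment> \<open>The weight \<open>(1/2) ^ n\<close> missing from the partial sum is placed on
      the point 0, which belongs to \<open>K\<close>.\<close>
    define w where "w = (\<lambda>j. if j < n then (1/2) ^ Suc j else (1/2::real) ^ n)"
    define y where "y = (\<lambda>j. if j < n then z j else 0)"
    have w1: "(\<Sum>j<n. (1/2) ^ Suc j) + (1/2::real) ^ n = 1" by (induction n) auto
    have sw: "sum w {..<Suc n} = 1"
      using w1 by (simp add: w_def)
    have "(\<Sum>j\<in>{..<Suc n}. w j *\<^sub>R y j) \<in> convex hull K"
      by (rule convex_sum[OF _ convex_convex_hull sw])
        (auto simp: w_def y_def K_def intro: hull_inc)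
    moreover have "(\<Sum>j\<in>{..<Suc n}. w j *\<^sub>R y j) = R n"
      by (simp add: w_def y_def R_def)
    ultimately show ?thesis by simp
  qed
  then have R: "R n \<in> closure (convex hull K)" for n using closure_subset by blast
  have lim: "(\<lambda>n. \<phi> (R n)) \<longlonglongrightarrow> (\<Sum>j. (1/2) ^ Suc j * \<phi> (z j))" if \<phi>: "\<phi> \<in> top_dual" for \<phi>
  proof -
    have lin: "linear \<phi>" by (rule top_dualD(1)[OF \<phi>])
    have "(\<lambda>j. \<phi> (z j)) \<longlonglongrightarrow> \<phi> 0" by (rule top_dualD(3)[OF \<phi> z])
    then have "Bseq (\<lambda>j. \<phi> (z j))" by (intro convergent_imp_Bseq convergentI)
    then obtain c where c: "\<And>j. \<bar>\<phi> (z j)\<bar> \<le> c" by (auto simp: Bseq_def)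
    have "summable (\<lambda>j. (1/2) ^ Suc j * \<phi> (z j))"
    proof (rule summable_comparison_test'[of "\<lambda>j. c * (1/2) ^ j" 0])
      show "norm ((1/2) ^ Suc j * \<phi> (z j)) \<le> c * (1/2) ^ j" for j
      proof -
        have "norm ((1/2) ^ Suc j * \<phi> (z j)) = 1/2 * ((1/2) ^ j * \<bar>\<phi> (z j)\<bar>)" by (simp add: abs_mult)
        also have "\<dots> \<le> 1 * ((1/2) ^ j * \<bar>\<phi> (z j)\<bar>)" by (intro mult_right_mono) auto
        also have "\<dots> \<le> 1 * ((1/2) ^ j * c)" using c by (intro mult_left_mono) auto
        finally show ?thesis by (simp add: mult.commute)
      qed
    qed (auto intro!: summable_mult)
    moreover have "\<phi> (R n) = (\<Sum>j<n. (1/2) ^ Suc j * \<phi> (z j))" for n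
      unfolding R_def by (simp add: linear_sum[OF lin] linear_scale[OF lin])
    ultimately show ?thesis using summable_LIMSEQ by (simp only:)
  qed
  show ?thesis
    by (rule weak_limit_in_compact[where L = "\<lambda>\<phi>. \<Sum>j. (1/2) ^ Suc j * \<phi> (z j)", OF C R lim])
      (assumption | rule that)+
qed

text \<open>The gliding hump is used with the roles exchanged: the large values occur at functionals
  of dual norm at most 1 and the series runs over points of \<open>B\<close>. Its sum
  \<open>y\<close> exists in the space, and all the humps would have to lie below the single number
  \<open>\<pi> y\<close>.\<close>

lemma weakly_bounded_imp_pi_bounded:
  assumes wb: "\<And>\<phi>. \<phi> \<in> top_dual \<Longrightarrow> \<exists>c. \<forall>x\<in>B. \<bar>\<phi> x\<bar> \<le> c"
  shows "\<exists>c. \<forall>x\<in>B. \<pi> x \<le> c"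
proof (rule ccontr)
  assume neg: "\<nexists>c. \<forall>x\<in>B. \<pi> x \<le> c"
  define A where "A = {\<phi> \<in> top_dual. dual_norm \<pi> \<phi> \<le> 1}"
  have unb: "\<exists>\<phi>\<in>A. \<exists>x\<in>B. \<bar>\<phi> x\<bar> > N" for N
  proof -
    obtain x where x: "x \<in> B" "\<pi> x > N" using neg by (meson not_le)
    have "\<exists>\<phi>\<in>A. \<bar>\<phi> x\<bar> > N" using pi_le[of x N] x(2) unfolding A_def by (auto simp: not_le[symmetric])
    then show ?thesis using x(1) by blast
  qed
  have wbA: "\<exists>c. \<forall>x\<in>B. \<bar>\<phi> x\<bar> \<le> c" if "\<phi> \<in> A" for \<phi> using wb that by (simp add: A_def)
  obtain \<phi> x and s :: "nat \<Rightarrow> real"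
    where s: "\<And>k. \<phi> k \<in> A" "\<And>k. x k \<in> B" "\<And>k. \<bar>s k\<bar> = 1"
      "\<And>k. \<bar>\<Sum>j. s j * (1/3) ^ j * \<phi> k (x j)\<bar> \<ge> (4/3) ^ k / 4"
    by (rule gliding_hump[where b = "\<lambda>\<phi> x. \<phi> x" and A = A and D = B, OF wbA unb])
      (assumption | rule that)+
  \<comment> \<open>The factors are arranged so that the weight \<open>(1/2) ^ Suc j\<close> of the
    weak series times \<open>2 * (2/3) ^ j\<close> is the weight \<open>(1/3) ^ j\<close> of the
    gliding hump. The remaining decay \<open>(2/3) ^ j\<close> makes \<open>z\<close> a null
    sequence by Mackey's theorem.\<close>
  define z where "z = (\<lambda>j. (2 * (2/3) ^ j * s j) *\<^sub>R x j)"
  have "z \<longlonglongrightarrow> 0"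
  proof (rule topological_tendstoI)
    fix U :: "'a set" assume U: "open U" "0 \<in> U"
    obtain r where r: "r > 0" "\<And>x c. x \<in> B \<Longrightarrow> \<bar>c\<bar> \<le> r \<Longrightarrow> c *\<^sub>R x \<in> U"
      using weakly_bounded_absorbed[OF wb U] by blast
    have "(\<lambda>j. 2 * (2/3::real) ^ j) \<longlonglongrightarrow> 2 * 0" by (intro tendsto_intros LIMSEQ_power_zero) simp
    then have "eventually (\<lambda>j. 2 * (2/3::real) ^ j < r) sequentially"
      using r(1) by (intro order_tendstoD(2)) simp_all
    then show "eventually (\<lambda>j. z j \<in> U) sequentially"
      by eventually_elim (auto simp: z_def abs_mult s(3) intro!: r(2) s(2))
  qed
  then obtain y where y: "\<And>\<phi>. \<phi> \<in> top_dual \<Longrightarrow> \<phi> y = (\<Sum>j. (1/2) ^ Suc j * \<phi> (z j))"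
    using weak_series by blast
  have "(4/3) ^ k / 4 \<le> \<pi> y" for k
  proof -
    have \<phi>: "\<phi> k \<in> top_dual" "dual_norm \<pi> (\<phi> k) \<le> 1" using s(1)[of k] by (auto simp: A_def)
    have "(1/2) ^ Suc j * \<phi> k (z j) = s j * (1/3) ^ j * \<phi> k (x j)" for j
    proof -
      have "(1/2::real) ^ j * (2/3) ^ j = (1/3) ^ j" by (simp flip: power_mult_distrib)
      moreover have "(1/2) ^ Suc j * \<phi> k (z j) = ((1/2) ^ j * (2/3) ^ j) * (s j * \<phi> k (x j))"
        by (simp add: z_def linear_scale[OF top_dualD(1)[OF \<phi>(1)]])
      ultimately show ?thesis by simp
    qed
    then have "\<phi> k y = (\<Sum>j. s j * (1/3) ^ j * \<phi> k (x j))" using y[OF \<phi>(1)] by simp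
    then show ?thesis using s(4)[of k] unit_functional_le[OF \<phi>, of y] by simp
  qed
  then show False using unbounded_geometric[of "\<pi> y"] by (meson not_le)
qed

text \<open>Equal-weight Riemann sums lie in the convex hull of the curve, and a cluster point of
  them has the required functional values. Its membership in the closed hull is recorded because it
  controls the mean in the topology itself.\<close>

lemma weak_mean:
  fixes \<gamma> :: "real \<Rightarrow> 'a"
  assumes ab: "a < b" and \<gamma>: "continuous_on {a..b} \<gamma>"
  obtains y where "y \<in> closure (convex hull (\<gamma> ` {a..b}))"
    "\<And>\<phi>. \<phi> \<in> top_dual \<Longrightarrow> \<phi> y = integral {a..b} (\<lambda>t. \<phi> (\<gamma> t)) / (b - a)"
proof -
  let ?K = "\<gamma> ` {a..b}"
  have "compact ?K" by (rule compact_continuous_image[OF \<gamma> compact_Icc])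
  moreover have "metrizable_space (top_of_set ?K)"
    by (rule metrizable_curve[OF compact_Icc \<gamma>]) (use top_dual_separates in blast)
  ultimately have C: "compact (closure (convex hull ?K))"
    using cc unfolding compact_convex_closures_def by blast
  define R where "R = (\<lambda>n. \<Sum>k<Suc n. (1 / Suc n) *\<^sub>R \<gamma> (a + k * ((b - a) / Suc n)))"
  have "R n \<in> convex hull ?K" for n
    unfolding R_def
  proof (rule convex_sum[OF _ convex_convex_hull])
    fix k assume k: "k \<in> {..<Suc n}"
    have "real k * ((b - a) / Suc n) \<le> Suc n * ((b - a) / Suc n)"
      using k ab by (intro mult_right_mono) auto
    then have "a + k * ((b - a) / Suc n) \<in> {a..b}" using ab by auto
    then show "\<gamma> (a + k * ((b - a) / Suc n)) \<in> convex hull ?K" by (intro hull_inc imageI)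
  qed auto
  then have R: "R n \<in> closure (convex hull ?K)" for n using closure_subset by blast
  have lim: "(\<lambda>n. \<phi> (R n)) \<longlonglongrightarrow> integral {a..b} (\<lambda>t. \<phi> (\<gamma> t)) / (b - a)"
    if \<phi>: "\<phi> \<in> top_dual" for \<phi>
  proof -
    have lin: "linear \<phi>" by (rule top_dualD(1)[OF \<phi>])
    have "continuous_on {a..b} (\<lambda>t. \<phi> (\<gamma> t))"
      using continuous_on_compose[OF \<gamma> top_dualD(2)[OF \<phi>]] by (simp add: o_def)
    from riemann_sum_tendsto[OF this ab] show ?thesis
      unfolding R_def by (simp only: linear_sum[OF lin] linear_scale[OF lin] real_scaleR_def)
  qed
  show ?thesis
    by (rule weak_limit_in_compact[where L = "\<lambda>\<phi>. integral {a..b} (\<lambda>t. \<phi> (\<gamma> t)) / (b - a)", OF C R lim])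
      (assumption | rule that)+
qed

end

section \<open>Real functions\<close>

text \<open>The generator yields only right derivatives. For each \<open>e > 0\<close> the last
  point at which the increment from \<open>a\<close> is at most \<open>e\<close> times the distance
  must be \<open>b\<close>, since a vanishing right derivative would push it further.\<close>

lemma right_derivative_zero_imp_const:
  fixes k :: "real \<Rightarrow> real"
  assumes ab: "a \<le> b" and cont: "continuous_on {a..b} k"
    and der: "\<And>t. a \<le> t \<Longrightarrow> t < b \<Longrightarrow> (k has_real_derivative 0) (at_right t)"
  shows "k b = k a"
proof -
  have le: "\<bar>k b - k a\<bar> \<le> e * (b - a)" if e: "e > 0" for e
  proof -
    define S where "S = {t \<in> {a..b}. \<bar>k t - k a\<bar> \<le> e * (t - a)}"
    have "closed S" unfolding S_def
      by (rule continuous_on_closed_Collect_le) (use cont in \<open>auto intro!: continuous_intros\<close>)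
    moreover have "S \<subseteq> {a..b}" by (auto simp: S_def)
    ultimately have "compact S" using compact_Int_closed[OF compact_Icc, of S a b] by (simp add: Int_absorb1)
    moreover have "a \<in> S" using ab by (simp add: S_def)
    ultimately obtain m where m: "m \<in> S" "\<And>t. t \<in> S \<Longrightarrow> t \<le> m"
      using compact_attains_sup[of S] by blast
    have "m = b"
    proof (rule ccontr)
      assume "m \<noteq> b"
      then have mb: "a \<le> m" "m < b" using m(1) by (auto simp: S_def)
      have "((\<lambda>y. (k y - k m) / (y - m)) \<longlongrightarrow> 0) (at_right m)"
        using der[OF mb] by (simp add: has_field_derivative_iff)
      then have "eventually (\<lambda>y. dist ((k y - k m) / (y - m)) 0 < e) (at_right m)"
        using e by (rule tendstoD)
      moreover have "eventually (\<lambda>y. y < b) (at_right m)"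
        using mb(2) by (simp add: eventually_at_right_field) blast
      moreover have "eventually (\<lambda>y. m < y) (at_right m)" by (rule eventually_at_right_less)
      ultimately have "eventually (\<lambda>y. m < y \<and> y < b \<and> \<bar>(k y - k m) / (y - m)\<bar> < e) (at_right m)"
        by eventually_elim auto
      then have "\<exists>y. m < y \<and> y < b \<and> \<bar>(k y - k m) / (y - m)\<bar> < e"
        by (rule eventually_happens'[rotated]) simp
      then obtain y where y: "m < y" "y < b" "\<bar>(k y - k m) / (y - m)\<bar> < e" by blast
      have "\<bar>k y - k m\<bar> \<le> e * (y - m)" using y by (simp add: abs_divide field_simps)
      moreover have "\<bar>k m - k a\<bar> \<le> e * (m - a)" using m(1) by (simp add: S_def)
      ultimately have "\<bar>k y - k a\<bar> \<le> e * (y - a)" by (simp add: algebra_simps abs_le_iff)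
      then have "y \<in> S" using y mb by (simp add: S_def)
      then show False using m(2)[of y] y(1) by simp
    qed
    then show ?thesis using m(1) by (simp add: S_def)
  qed
  have "\<bar>k b - k a\<bar> \<le> 0"
  proof (rule field_le_epsilon)
    fix e :: real assume e: "e > 0"
    have "e / (b - a + 1) * (b - a) \<le> e" using e ab by (simp add: field_simps)
    then show "\<bar>k b - k a\<bar> \<le> 0 + e" using le[of "e / (b - a + 1)"] e ab by simp
  qed
  then show ?thesis by simp
qed

lemma nn_integral_atLeast_le:
  fixes g :: "real \<Rightarrow> real"
  assumes g: "continuous_on {0..} g" and nonneg: "\<And>t. 0 \<le> t \<Longrightarrow> 0 \<le> g t"
    and le: "\<And>n::nat. integral {0..real n} g \<le> c"
  shows "(\<integral>\<^sup>+t\<in>{0..}. ennreal (g t) \<partial>lborel) \<le> ennreal c"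
proof -
  \<comment> \<open>Extending \<open>g\<close> by a constant to the left of 0 gives a continuous,
    hence Borel measurable, function on the whole line.\<close>
  define h where "h = (\<lambda>t. g (max 0 t))"
  have "continuous_on UNIV h"
    unfolding h_def by (rule continuous_on_compose2[OF g]) (auto intro!: continuous_intros)
  then have h[measurable]: "h \<in> borel_measurable borel" by (rule borel_measurable_continuous_onI)
  define f where "f = (\<lambda>n::nat. \<lambda>t. ennreal (h t) * indicator {0..real n} t)"
  have meas: "f n \<in> borel_measurable lborel" for n unfolding f_def by measurable
  have inc: "incseq f"
  proof (intro incseq_SucI le_funI)
    show "f n t \<le> f (Suc n) t" for n t
      unfolding f_def by (intro mult_left_mono) (auto split: split_indicator)
  qed
  have int: "integral\<^sup>N lborel (f n) \<le> ennreal c" for n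
  proof -
    have cont: "continuous_on {0..real n} g" by (rule continuous_on_subset[OF g]) auto
    let ?f = "\<lambda>t. if t \<in> {0..real n} then h t else 0"
    have "(h has_integral integral {0..real n} g) {0..real n}"
      using integrable_integral[OF integrable_continuous_interval[OF cont]]
      by (rule has_integral_eq[rotated]) (simp add: h_def)
    then have "(?f has_integral integral {0..real n} g) UNIV"
      by (simp only: has_integral_restrict_UNIV)
    moreover have "?f \<in> borel_measurable borel" by measurable
    moreover have "0 \<le> ?f t" for t using nonneg[of t] by (simp add: h_def)
    ultimately have "(\<integral>\<^sup>+t. ennreal (?f t) \<partial>lborel) = ennreal (integral {0..real n} g)"
      by (intro nn_integral_has_integral_lborel)
    moreover have "f n = (\<lambda>t. ennreal (?f t))" by (auto simp: f_def indicator_def fun_eq_iff)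
    ultimately show ?thesis using le[of n] by (simp only: ennreal_leI)
  qed
  have sup: "(SUP n. f n t) = ennreal (g t) * indicator {0..} t" for t
  proof (cases "t \<ge> 0")
    case True
    obtain n :: nat where n: "t \<le> real n" using real_arch_simple by blast
    have "(SUP n. f n t) = ennreal (h t)"
    proof (rule antisym)
      show "(SUP n. f n t) \<le> ennreal (h t)"
        by (rule SUP_least) (auto simp: f_def split: split_indicator)
      show "ennreal (h t) \<le> (SUP n. f n t)"
        by (rule SUP_upper2[of n]) (use n True in \<open>auto simp: f_def\<close>)
    qed
    then show ?thesis using True by (simp add: h_def)
  next
    case False
    then show ?thesis by (simp add: f_def)
  qed
  have "(\<integral>\<^sup>+t\<in>{0..}. ennreal (g t) \<partial>lborel) = (\<integral>\<^sup>+t. (SUP n. f n t) \<partial>lborel)"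
    by (simp add: sup)
  also have "\<dots> = (SUP n. integral\<^sup>N lborel (f n))"
    by (rule nn_integral_monotone_convergence_SUP[OF inc meas])
  also have "\<dots> \<le> ennreal c" by (rule SUP_least) (rule int)
  finally show ?thesis .
qed

text \<open>The sum is the integral of the step function with value \<open>u n\<close> on the
  \<open>n\<close>-th unit interval; these intervals are disjoint, so at most one term counts at
  each point.\<close>

lemma sum_le_nn_integral_atLeast:
  fixes g :: "real \<Rightarrow> real"
  assumes le: "\<And>n t. real n \<le> t \<Longrightarrow> t < real n + 1 \<Longrightarrow> u n \<le> g t" and nonneg: "\<And>n. 0 \<le> u n"
  shows "ennreal (\<Sum>n<N. u n) \<le> (\<integral>\<^sup>+t\<in>{0..}. ennreal (g t) \<partial>lborel)"
proof -
  have "ennreal (\<Sum>n<N. u n) = (\<Sum>n<N. \<integral>\<^sup>+t. ennreal (u n) * indicator {real n..<real n + 1} t \<partial>lborel)"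
    by (simp add: nn_integral_cmult_indicator sum_ennreal nonneg)
  also have "\<dots> = (\<integral>\<^sup>+t. (\<Sum>n<N. ennreal (u n) * indicator {real n..<real n + 1} t) \<partial>lborel)"
    by (rule nn_integral_sum[symmetric]) measurable
  also have "\<dots> \<le> (\<integral>\<^sup>+t\<in>{0..}. ennreal (g t) \<partial>lborel)"
  proof (rule nn_integral_mono)
    fix t :: real
    show "(\<Sum>n<N. ennreal (u n) * indicator {real n..<real n + 1} t) \<le> ennreal (g t) * indicator {0..} t"
    proof (cases "t \<ge> 0")
      case True
      define m where "m = nat \<lfloor>t\<rfloor>"
      have m: "real m \<le> t" "t < real m + 1" using True by (auto simp: m_def)
      have ind: "indicator {real n..<real n + 1} t = (if n = m then 1 else 0 :: ennreal)" for n
        using m by (auto simp: indicator_def)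
      have "(\<Sum>n<N. ennreal (u n) * indicator {real n..<real n + 1} t) = (if m < N then ennreal (u m) else 0)"
        unfolding ind by (simp add: if_distrib cong: if_cong)
      also have "\<dots> \<le> ennreal (g t)" using le[OF m] by (simp add: ennreal_leI)
      finally show ?thesis using True by simp
    next
      case False
      then have "indicator {real n..<real n + 1} t = (0 :: ennreal)" for n by (auto simp: indicator_def)
      then show ?thesis by simp
    qed
  qed
  finally show ?thesis .
qed

section \<open>The semigroup and its generator\<close>

locale Cb_semigroup_pair = norming_pair \<pi>
  for \<pi> :: "'a::locally_convex_space \<Rightarrow> real" +
  fixes T :: "real \<Rightarrow> 'a \<Rightarrow> 'a"
  assumes semigroup: "Cb_semigroup T"
begin

lemma T_linear: "0 \<le> t \<Longrightarrow> linear (T t)" and T_cont: "0 \<le> t \<Longrightarrow> continuous_on UNIV (T t)"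
  and T_0 [simp]: "T 0 x = x" and T_orbit: "continuous_on {0..} (\<lambda>t. T t x)"
  using semigroup by (auto simp: Cb_semigroup_def)

lemma T_add: "0 \<le> t \<Longrightarrow> 0 \<le> s \<Longrightarrow> T (t + s) x = T t (T s x)"
  using semigroup by (auto simp: Cb_semigroup_def)

lemma adjoint_top_dual: "\<phi> \<in> top_dual \<Longrightarrow> 0 \<le> t \<Longrightarrow> \<phi> \<circ> T t \<in> top_dual"
  using linear_compose[OF T_linear[of t] top_dualD(1)]
    continuous_on_compose[OF T_cont[of t] top_dualD(2)]
  unfolding top_dual_def by blast

lemma orbit_cont: "\<phi> \<in> top_dual \<Longrightarrow> S \<subseteq> {0..} \<Longrightarrow> continuous_on S (\<lambda>t. \<phi> (T t x))"
  using continuous_on_compose[OF continuous_on_subset[OF T_orbit] top_dualD(2)] by (simp add: o_def)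

lemma orbit_integrable: "\<phi> \<in> top_dual \<Longrightarrow> 0 \<le> a \<Longrightarrow> (\<lambda>t. \<phi> (T t x)) integrable_on {a..b}"
  by (intro integrable_continuous_interval orbit_cont) auto

lemma orbit_integral_combine:
  "\<phi> \<in> top_dual \<Longrightarrow> 0 \<le> a \<Longrightarrow> a \<le> b \<Longrightarrow> b \<le> c \<Longrightarrow>
   integral {a..c} (\<lambda>t. \<phi> (T t x)) = integral {a..b} (\<lambda>t. \<phi> (T t x)) + integral {b..c} (\<lambda>t. \<phi> (T t x))"
  using Henstock_Kurzweil_Integration.integral_combine[of a b c "\<lambda>t. \<phi> (T t x)"] orbit_integrable
  by simp

lemma orbit_integral_shift:
  assumes "\<phi> \<in> top_dual" "0 \<le> h" "0 \<le> a"
  shows "integral {a..b} (\<lambda>t. (\<phi> \<circ> T h) (T t x)) = integral {a + h..b + h} (\<lambda>t. \<phi> (T t x))"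
proof -
  have "integral {a..b} (\<lambda>t. (\<phi> \<circ> T h) (T t x)) = integral {a..b} (\<lambda>t. \<phi> (T (t + h) x))"
    using assms by (intro integral_cong) (simp add: T_add[symmetric] add.commute)
  also have "\<dots> = integral {a + h..b + h} (\<lambda>t. \<phi> (T t x))"
    using integral_shift_real_ivl[of "a + h" h "b + h" "\<lambda>t. \<phi> (T t x)"] by simp
  finally show ?thesis .
qed

lemma orbit_integral:
  assumes "0 \<le> a"
  obtains y where "\<And>\<phi>. \<phi> \<in> top_dual \<Longrightarrow> \<phi> y = integral {0..a} (\<lambda>t. \<phi> (T t x))"
proof (cases "a = 0")
  case True
  then show ?thesis by (intro that[of 0]) (simp add: linear_0[OF top_dualD(1)])
next
  case False
  then have a: "0 < a" using assms by simp
  obtain y where y: "\<And>\<phi>. \<phi> \<in> top_dual \<Longrightarrow> \<phi> y = integral {0..a} (\<lambda>t. \<phi> (T t x)) / (a - 0)"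
    using weak_mean[OF a continuous_on_subset[OF T_orbit], of x] by auto
  show ?thesis
    using a by (intro that[of "a *\<^sub>R y"]) (simp add: y linear_scale[OF top_dualD(1)])
qed

text \<open>Weak data determine \<open>Y h\<close>, so it equals the mean in the closed convex hull
  of the orbit over \<open>{0..h}\<close>. For small \<open>h\<close> that hull lies in the closure
  of a convex neighbourhood of \<open>x\<close>, which gives convergence in the topology
  itself.\<close>

lemma orbit_mean_tendsto:
  assumes Y: "\<And>h \<phi>. 0 < h \<Longrightarrow> \<phi> \<in> top_dual \<Longrightarrow> \<phi> (Y h) = integral {0..h} (\<lambda>t. \<phi> (T t x)) / h"
  shows "(Y \<longlongrightarrow> x) (at_right 0)"
proof (rule topological_tendstoI)
  fix U :: "'a set" assume U: "open U" "x \<in> U"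
  \<comment> \<open>Continuity of addition provides \<open>V\<close> with \<open>x + V + V\<close>
    inside \<open>U\<close>, so that even the closure of \<open>x + V\<close> stays in
    \<open>U\<close>.\<close>
  have "((\<lambda>p. x + (fst p + snd p)) \<longlongrightarrow> x + (0 + 0)) (nhds (0::'a) \<times>\<^sub>F nhds 0)"
    by (intro tendsto_intros filterlim_fst filterlim_snd)
  then have "eventually (\<lambda>p. x + (fst p + snd p) \<in> U) (nhds (0::'a) \<times>\<^sub>F nhds 0)"
    using U by (auto dest: topological_tendstoD)
  then obtain P Q where PQ: "eventually P (nhds (0::'a))" "eventually Q (nhds (0::'a))"
    "\<And>v w. P v \<Longrightarrow> Q w \<Longrightarrow> x + (v + w) \<in> U"
    by (auto simp: eventually_prod_filter)
  then obtain W where W: "open W" "0 \<in> W" "\<And>v. v \<in> W \<Longrightarrow> P v \<and> Q v"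
    using eventually_conj[OF PQ(1,2)] unfolding eventually_nhds by blast
  obtain V where V: "open V" "0 \<in> V" "V \<subseteq> W" "convex V" "\<And>v. v \<in> V \<Longrightarrow> - v \<in> V"
    using convex_symmetric_neighbourhood[OF W(1,2)] by blast
  have VU: "x + (v + w) \<in> U" if "v \<in> V" "w \<in> V" for v w
    using that V(3) W(3) PQ(3) by blast
  define N where "N = (\<lambda>y. y - x) -` V"
  have N: "open N" "x \<in> N"
    unfolding N_def using V by (auto intro!: open_vimage continuous_intros)
  have "convex N"
  proof -
    have "N = (+) x ` V"
    proof
      show "N \<subseteq> (+) x ` V"
      proof
        fix y assume "y \<in> N"
        then show "y \<in> (+) x ` V" by (intro image_eqI[of _ _ "y - x"]) (auto simp: N_def)
      qed
    qed (auto simp: N_def)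
    then show ?thesis using convex_translation[OF V(4), of x] by simp
  qed
  have closure: "closure N \<subseteq> U"
  proof
    fix y assume y: "y \<in> closure N"
    have "open ((\<lambda>u. u - y) -` V)" using V by (auto intro!: open_vimage continuous_intros)
    moreover have "y \<in> (\<lambda>u. u - y) -` V" using V(2) by simp
    ultimately obtain u where u: "u \<in> N" "u - y \<in> V"
      using y unfolding closure_iff_nhds_not_empty by blast
    have "x + ((u - x) + - (u - y)) \<in> U" using u(1) V(5)[OF u(2)] by (intro VU) (auto simp: N_def)
    then show "y \<in> U" by simp
  qed
  have "((\<lambda>t. T t x) \<longlongrightarrow> T 0 x) (at 0 within {0..})"
    using T_orbit[of x] unfolding continuous_on_def by (rule bspec) simp
  then have "eventually (\<lambda>t. T t x \<in> N) (at 0 within {0..})"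
    using N by (auto dest: topological_tendstoD)
  then obtain d where "d > 0" and ev: "\<And>t. t \<in> {0..} \<Longrightarrow> t \<noteq> 0 \<Longrightarrow> dist t 0 < d \<Longrightarrow> T t x \<in> N"
    unfolding eventually_at by blast
  have d: "T t x \<in> N" if "0 \<le> t" "t < d" for t
    using ev[of t] that N(2) by (cases "t = 0") (auto simp: dist_real_def)
  have "Y h \<in> U" if h: "0 < h" "h < d" for h
  proof -
    have cont: "continuous_on {0..h} (\<lambda>t. T t x)" by (rule continuous_on_subset[OF T_orbit]) auto
    obtain y where y: "y \<in> closure (convex hull ((\<lambda>t. T t x) ` {0..h}))"
      "\<And>\<phi>. \<phi> \<in> top_dual \<Longrightarrow> \<phi> y = integral {0..h} (\<lambda>t. \<phi> (T t x)) / (h - 0)"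
      by (rule weak_mean[OF h(1) cont]) (rule that)
    have "convex hull ((\<lambda>t. T t x) ` {0..h}) \<subseteq> N"
      using d h \<open>convex N\<close> by (intro hull_minimal) auto
    then have "closure (convex hull ((\<lambda>t. T t x) ` {0..h})) \<subseteq> closure N" by (rule closure_mono)
    then have "y \<in> U" using y(1) closure by blast
    moreover have "Y h = y" by (rule top_dual_separates) (simp add: y(2) Y[OF h(1)])
    ultimately show ?thesis by simp
  qed
  then show "eventually (\<lambda>h. Y h \<in> U) (at_right 0)"
    using \<open>d > 0\<close> by (auto simp: eventually_at_right_field)
qed

lemma gen_domain_tendsto:
  assumes "w \<in> gen_domain T"
  shows "((\<lambda>t. (1 / t) *\<^sub>R (T t w - w)) \<longlongrightarrow> generator T w) (at_right 0)"
proof -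
  obtain y where y: "((\<lambda>t. (1 / t) *\<^sub>R (T t w - w)) \<longlongrightarrow> y) (at_right 0)"
    using assms by (auto simp: gen_domain_def)
  then have "generator T w = y" unfolding generator_def by (intro tendsto_Lim) auto
  then show ?thesis using y by simp
qed

lemma gen_domainI:
  assumes "((\<lambda>t. (1 / t) *\<^sub>R (T t w - w)) \<longlongrightarrow> y) (at_right 0)"
  shows "w \<in> gen_domain T" "generator T w = y"
proof -
  show "w \<in> gen_domain T" using assms by (auto simp: gen_domain_def)
  show "generator T w = y" unfolding generator_def by (rule tendsto_Lim) (use assms in auto)
qed

text \<open>The difference quotient at \<open>h\<close> is, up to sign, a weak mean of the orbit of
  \<open>y\<close>, so the weak identity already forces its convergence in the topology.\<close>

lemma gen_domainI_weak:
  assumes w: "\<And>h \<phi>. 0 < h \<Longrightarrow> \<phi> \<in> top_dual \<Longrightarrow> \<phi> (T h w) - \<phi> w = - integral {0..h} (\<lambda>t. \<phi> (T t y))"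
  shows "w \<in> gen_domain T" "generator T w = - y"
proof -
  have "((\<lambda>h. - ((1 / h) *\<^sub>R (T h w - w))) \<longlongrightarrow> y) (at_right 0)"
  proof (rule orbit_mean_tendsto)
    fix h :: real and \<phi> :: "'a \<Rightarrow> real" assume h: "0 < h" and \<phi>: "\<phi> \<in> top_dual"
    note lin = top_dualD(1)[OF \<phi>]
    show "\<phi> (- ((1 / h) *\<^sub>R (T h w - w))) = integral {0..h} (\<lambda>t. \<phi> (T t y)) / h"
      using w[OF h \<phi>] by (simp add: linear_neg[OF lin] linear_scale[OF lin] linear_diff[OF lin])
  qed
  from tendsto_minus[OF this] have "((\<lambda>h. (1 / h) *\<^sub>R (T h w - w)) \<longlongrightarrow> - y) (at_right 0)" by simp
  from gen_domainI[OF this] show "w \<in> gen_domain T" "generator T w = - y" by auto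
qed

text \<open>The orbit minus the integral of its expected derivative has right derivative 0 under
  \<open>\<phi>\<close> and is continuous, hence constant.\<close>

lemma generator_orbit:
  assumes w: "w \<in> gen_domain T" and \<phi>: "\<phi> \<in> top_dual" and t: "0 \<le> t"
  shows "\<phi> (T t w) - \<phi> w = integral {0..t} (\<lambda>s. \<phi> (T s (generator T w)))"
proof -
  let ?g = "\<lambda>s. \<phi> (T s (generator T w))"
  define k where "k = (\<lambda>s. \<phi> (T s w) - integral {0..s} ?g)"
  have cont: "continuous_on {0..t} ?g" by (rule orbit_cont[OF \<phi>]) auto
  have "k t = k 0"
  proof (rule right_derivative_zero_imp_const[OF t])
    have "continuous_on {0..t} (\<lambda>s. integral {0..s} ?g)"
      by (rule indefinite_integral_continuous_1[OF integrable_continuous_interval[OF cont]])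
    then show "continuous_on {0..t} k"
      unfolding k_def by (intro continuous_intros orbit_cont[OF \<phi>]) auto
  next
    fix s assume s: "0 \<le> s" "s < t"
    have "((\<lambda>u. integral {0..u} ?g) has_real_derivative ?g s) (at s within {0..t})"
      using integral_has_vector_derivative[OF cont, of s] s
      by (simp add: has_real_derivative_iff_has_vector_derivative)
    then have "((\<lambda>u. integral {0..u} ?g) has_real_derivative ?g s) (at s within {s..t})"
      by (rule has_field_derivative_subset) (use s in auto)
    then have 1: "((\<lambda>u. integral {0..u} ?g) has_real_derivative ?g s) (at_right s)"
      using s by (simp add: at_within_Icc_at_right)
    have \<psi>: "\<phi> \<circ> T s \<in> top_dual" by (rule adjoint_top_dual[OF \<phi> s(1)])
    \<comment> \<open>The right derivative at \<open>s\<close> is the one at 0 seen through the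
      continuous functional \<open>\<phi> \<circ> T s\<close>.\<close>
    have "((\<lambda>h. (\<phi> \<circ> T s) ((1 / h) *\<^sub>R (T h w - w))) \<longlongrightarrow> (\<phi> \<circ> T s) (generator T w)) (at_right 0)"
      by (rule top_dualD(3)[OF \<psi> gen_domain_tendsto[OF w]])
    moreover have "eventually (\<lambda>h. (\<phi> \<circ> T s) ((1 / h) *\<^sub>R (T h w - w))
        = (\<phi> (T (h + s) w) - \<phi> (T s w)) / (h + s - s)) (at_right 0)"
      using eventually_at_right_less[of "0::real"]
    proof eventually_elim
      case (elim h)
      have "(\<phi> \<circ> T s) ((1 / h) *\<^sub>R (T h w - w)) = ((\<phi> \<circ> T s) (T h w) - (\<phi> \<circ> T s) w) / h"
        by (simp only: linear_scale[OF top_dualD(1)[OF \<psi>]] linear_diff[OF top_dualD(1)[OF \<psi>]]) simp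
      also have "(\<phi> \<circ> T s) (T h w) = \<phi> (T (h + s) w)"
        using elim s(1) by (simp add: T_add[symmetric] add.commute)
      finally show ?case by simp
    qed
    ultimately have "((\<lambda>h. (\<phi> (T (h + s) w) - \<phi> (T s w)) / (h + s - s)) \<longlongrightarrow> ?g s) (at_right 0)"
      by (auto elim!: Lim_transform_eventually)
    then have 2: "((\<lambda>u. \<phi> (T u w)) has_real_derivative ?g s) (at_right s)"
      unfolding has_field_derivative_iff filterlim_at_right_to_0[of _ _ s] .
    show "(k has_real_derivative 0) (at_right s)"
      using DERIV_diff[OF 2 1] unfolding k_def by simp
  qed
  then show ?thesis by (simp add: k_def)
qed

lemma generator_add:
  assumes "v \<in> gen_domain T" "w \<in> gen_domain T"
  shows "v + w \<in> gen_domain T" "generator T (v + w) = generator T v + generator T w"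
proof -
  have "eventually (\<lambda>t. (1 / t) *\<^sub>R (T t v - v) + (1 / t) *\<^sub>R (T t w - w)
      = (1 / t) *\<^sub>R (T t (v + w) - (v + w))) (at_right 0)"
    using eventually_at_right_less[of "0::real"]
  proof eventually_elim
    case (elim t)
    have "T t (v + w) - (v + w) = (T t v - v) + (T t w - w)"
      using linear_add[OF T_linear, of t v w] elim by simp
    then show ?case by (simp only: scaleR_add_right)
  qed
  then have "((\<lambda>t. (1 / t) *\<^sub>R (T t (v + w) - (v + w))) \<longlongrightarrow> generator T v + generator T w) (at_right 0)"
    using tendsto_add[OF assms[THEN gen_domain_tendsto]] by (rule Lim_transform_eventually[rotated])
  from gen_domainI[OF this] show "v + w \<in> gen_domain T"
    "generator T (v + w) = generator T v + generator T w" by auto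
qed

lemma generator_scale:
  assumes "w \<in> gen_domain T"
  shows "c *\<^sub>R w \<in> gen_domain T" "generator T (c *\<^sub>R w) = c *\<^sub>R generator T w"
proof -
  have "eventually (\<lambda>t. c *\<^sub>R (1 / t) *\<^sub>R (T t w - w)
      = (1 / t) *\<^sub>R (T t (c *\<^sub>R w) - c *\<^sub>R w)) (at_right 0)"
    using eventually_at_right_less[of "0::real"]
  proof eventually_elim
    case (elim t)
    have "T t (c *\<^sub>R w) - c *\<^sub>R w = c *\<^sub>R (T t w - w)"
      using linear_scale[OF T_linear, of t c w] elim by (simp add: scaleR_diff_right)
    then show ?case by (simp add: mult.commute)
  qed
  then have "((\<lambda>t. (1 / t) *\<^sub>R (T t (c *\<^sub>R w) - c *\<^sub>R w)) \<longlongrightarrow> c *\<^sub>R generator T w) (at_right 0)"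
    using lcs_tendsto_scaleR[OF tendsto_const gen_domain_tendsto[OF assms]]
    by (rule Lim_transform_eventually[rotated])
  from gen_domainI[OF this] show "c *\<^sub>R w \<in> gen_domain T"
    "generator T (c *\<^sub>R w) = c *\<^sub>R generator T w" by auto
qed

end

section \<open>Exponential stability\<close>

context Cb_semigroup_pair
begin

lemma adjoint_bound: "\<phi> \<in> top_dual \<Longrightarrow> 0 \<le> t \<Longrightarrow> \<bar>\<phi> (T t x)\<bar> \<le> dual_norm \<pi> (\<phi> \<circ> T t) * \<pi> x"
  using top_dual_bound[OF adjoint_top_dual, of \<phi> t x] by simp

lemma pi_le_scale:
  assumes L: "linear L" and le: "\<And>x. \<pi> x \<le> 1 \<Longrightarrow> \<pi> (L x) \<le> c"
  shows "\<pi> (L x) \<le> c * \<pi> x"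
proof (cases "\<pi> x = 0")
  case True
  then show ?thesis using pi_eq_0[OF True] linear_0[OF L] by simp
next
  case False
  then have pos: "\<pi> x > 0" using pi_nonneg[of x] by simp
  have "\<pi> (L ((1 / \<pi> x) *\<^sub>R x)) \<le> c" using pos by (intro le) (simp add: pi_scale)
  then show ?thesis using pos by (simp add: linear_scale[OF L] pi_scale field_simps)
qed

text \<open>With equal generator values the orbits of \<open>v\<close> and \<open>w\<close> have
  equal increments under each functional, so their difference is constant in time; decay of both
  orbits makes it 0.\<close>

lemma exp_stable_generator_inj:
  assumes stable: "\<And>x t. 0 \<le> t \<Longrightarrow> \<pi> (T t x) \<le> M * exp (- \<epsilon> * t) * \<pi> x" and \<epsilon>: "\<epsilon> > 0"
    and vw: "v \<in> gen_domain T" "w \<in> gen_domain T" "generator T v = generator T w"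
  shows "v = w"
proof (rule top_dual_separates)
  fix \<phi> :: "'a \<Rightarrow> real" assume \<phi>: "\<phi> \<in> top_dual"
  have null: "((\<lambda>t. \<phi> (T t x)) \<longlongrightarrow> 0) at_top" for x
  proof (rule Lim_null_comparison)
    show "eventually (\<lambda>t. norm (\<phi> (T t x)) \<le> dual_norm \<pi> \<phi> * (M * exp (- \<epsilon> * t) * \<pi> x)) at_top"
      using eventually_ge_at_top[of 0]
    proof eventually_elim
      case (elim t)
      show ?case
        using top_dual_bound[OF \<phi>, of "T t x"] mult_left_mono[OF stable[OF elim] top_dual_norm_nonneg[OF \<phi>]]
        by (metis order_trans real_norm_def)
    qed
    have "filterlim (\<lambda>t. - (\<epsilon> * t)) at_bot at_top"
      using \<epsilon> by (intro filterlim_uminus_at_bot_at_top[THEN filterlim_compose]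
          filterlim_tendsto_pos_mult_at_top[OF tendsto_const _ filterlim_ident])
    then have "((\<lambda>t. exp (- \<epsilon> * t)) \<longlongrightarrow> 0) at_top"
      using filterlim_compose[OF exp_at_bot] by simp
    then have "((\<lambda>t. dual_norm \<pi> \<phi> * (M * exp (- \<epsilon> * t) * \<pi> x)) \<longlongrightarrow> dual_norm \<pi> \<phi> * (M * 0 * \<pi> x)) at_top"
      by (intro tendsto_intros)
    then show "((\<lambda>t. dual_norm \<pi> \<phi> * (M * exp (- \<epsilon> * t) * \<pi> x)) \<longlongrightarrow> 0) at_top" by simp
  qed
  have "((\<lambda>t. \<phi> (T t v) - \<phi> (T t w)) \<longlongrightarrow> 0 - 0) at_top" by (intro tendsto_diff null)
  moreover have "eventually (\<lambda>t. \<phi> (T t v) - \<phi> (T t w) = \<phi> v - \<phi> w) at_top"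
    using eventually_ge_at_top[of 0]
  proof eventually_elim
    case (elim t)
    show ?case
      using generator_orbit[OF vw(1) \<phi> elim] generator_orbit[OF vw(2) \<phi> elim] vw(3) by simp
  qed
  ultimately have "((\<lambda>t::real. \<phi> v - \<phi> w) \<longlongrightarrow> 0) at_top"
    by (simp add: tendsto_cong)
  then show "\<phi> v = \<phi> w" by (simp add: tendsto_const_iff)
qed

text \<open>The solution is the integral of the orbit over \<open>[0, \<infinity>)\<close>; its existence comes from
  completeness for \<open>\<pi>\<close>, since the locally convex topology need not be complete.\<close>

lemma exp_stable_solve:
  assumes stable: "\<And>x t. 0 \<le> t \<Longrightarrow> \<pi> (T t x) \<le> M * exp (- \<epsilon> * t) * \<pi> x" and \<epsilon>: "\<epsilon> > 0"
  obtains w where "w \<in> gen_domain T" "generator T w = - y"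
    "\<pi> w \<le> M / (1 - exp (- \<epsilon>)) * \<pi> y"
    "\<forall>\<phi>\<in>top_dual. (\<forall>t\<ge>0. 0 \<le> \<phi> (T t y)) \<longrightarrow> 0 \<le> \<phi> w"
proof -
  define q where "q = exp (- \<epsilon>)"
  have q: "0 < q" "q < 1" using \<epsilon> by (auto simp: q_def)
  have exp_q: "exp (- \<epsilon> * real n) = q ^ n" for n
    by (simp add: q_def exp_of_nat_mult[symmetric] mult.commute)
  define c where "c = M * \<pi> y"
  \<comment> \<open>The stability estimate at time 0 gives \<open>\<pi> y \<le> c\<close>; the sign
    of \<open>M\<close> is not at hand directly.\<close>
  have c: "0 \<le> c" using stable[of 0 y] pi_nonneg[of y] by (simp add: c_def)
  have "\<exists>u. \<forall>\<phi>\<in>top_dual. \<phi> u = integral {0..real n} (\<lambda>t. \<phi> (T t y))" for n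
    using orbit_integral[of "real n" y] by (metis of_nat_0_le_iff)
  then obtain u where u: "\<And>n \<phi>. \<phi> \<in> top_dual \<Longrightarrow> \<phi> (u n) = integral {0..real n} (\<lambda>t. \<phi> (T t y))"
    by metis
  have tail: "\<bar>integral {real n..real n + h} (\<lambda>t. \<phi> (T t y))\<bar> \<le> dual_norm \<pi> \<phi> * (c * q ^ n) * h"
    if \<phi>: "\<phi> \<in> top_dual" and h: "0 \<le> h" for \<phi> n h
  proof -
    have "norm (integral {real n..real n + h} (\<lambda>t. \<phi> (T t y))) \<le> dual_norm \<pi> \<phi> * (c * q ^ n) * (real n + h - real n)"
    proof (rule Henstock_Kurzweil_Integration.integral_bound)
      show "continuous_on {real n..real n + h} (\<lambda>t. \<phi> (T t y))" by (rule orbit_cont[OF \<phi>]) auto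
      fix t assume t: "t \<in> {real n..real n + h}"
      have "exp (- \<epsilon> * t) \<le> q ^ n" unfolding exp_q[symmetric] using t \<epsilon> by simp
      then have "c * exp (- \<epsilon> * t) \<le> c * q ^ n" using c by (rule mult_left_mono)
      moreover have "\<pi> (T t y) \<le> c * exp (- \<epsilon> * t)"
        using stable[of t y] t by (simp add: c_def mult.assoc mult.commute mult.left_commute)
      ultimately have "\<pi> (T t y) \<le> c * q ^ n" by simp
      then have "dual_norm \<pi> \<phi> * \<pi> (T t y) \<le> dual_norm \<pi> \<phi> * (c * q ^ n)"
        using top_dual_norm_nonneg[OF \<phi>] by (rule mult_left_mono)
      then show "norm (\<phi> (T t y)) \<le> dual_norm \<pi> \<phi> * (c * q ^ n)"
        using top_dual_bound[OF \<phi>, of "T t y"] by simp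
    qed (use h in simp)
    then show ?thesis by simp
  qed
  have step: "\<pi> (u (Suc n) - u n) \<le> c * q ^ n" for n
  proof (rule pi_le)
    fix \<phi> assume \<phi>: "\<phi> \<in> top_dual" "dual_norm \<pi> \<phi> \<le> 1"
    have "\<phi> (u (Suc n) - u n) = integral {real n..real n + 1} (\<lambda>t. \<phi> (T t y))"
      using orbit_integral_combine[OF \<phi>(1), of 0 "real n" "real n + 1" y]
      by (simp add: linear_diff[OF top_dualD(1)[OF \<phi>(1)]] u[OF \<phi>(1)] add.commute)
    moreover have "dual_norm \<pi> \<phi> * (c * q ^ n) \<le> 1 * (c * q ^ n)"
      using \<phi>(2) c q by (intro mult_right_mono) auto
    ultimately show "\<bar>\<phi> (u (Suc n) - u n)\<bar> \<le> c * q ^ n" using tail[OF \<phi>(1), of 1 n] by simp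
  qed
  have diff: "\<pi> (u (n + k) - u n) \<le> c / (1 - q) * q ^ n" for n k
  proof -
    have "\<pi> (u (n + k) - u n) \<le> c / (1 - q) * (q ^ n - q ^ (n + k))"
    proof (induction k)
      case (Suc k)
      have "\<pi> (u (n + Suc k) - u n) \<le> \<pi> (u (Suc (n + k)) - u (n + k)) + \<pi> (u (n + k) - u n)"
        using pi_add[of "u (Suc (n + k)) - u (n + k)" "u (n + k) - u n"] by simp
      also have "\<dots> \<le> c * q ^ (n + k) + c / (1 - q) * (q ^ n - q ^ (n + k))"
        by (intro add_mono step Suc.IH)
      also have "c * q ^ (n + k) = c / (1 - q) * (q ^ (n + k) - q ^ (n + Suc k))"
        using q by (simp add: field_simps)
      finally show ?case by (simp add: algebra_simps)
    qed simp
    also have "\<dots> \<le> c / (1 - q) * q ^ n" using c q by (intro mult_left_mono) auto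
    finally show ?thesis .
  qed
  have qlim: "(\<lambda>n. C * q ^ n) \<longlonglongrightarrow> 0" for C
    using tendsto_mult_right_zero[OF LIMSEQ_power_zero[of q], of C] q by simp
  have "Metric_space.MCauchy UNIV (\<lambda>x y. \<pi> (x - y)) u"
    unfolding Metric_space.MCauchy_def[OF pi_metric]
  proof (intro conjI allI impI)
    fix e :: real assume e: "e > 0"
    have "eventually (\<lambda>n. c / (1 - q) * q ^ n < e / 2) sequentially"
      using e by (intro order_tendstoD(2)[OF qlim]) simp
    then obtain N where N: "c / (1 - q) * q ^ N < e / 2" by (auto simp: eventually_sequentially)
    have "\<pi> (u n - u m) < e" if "N \<le> n" "N \<le> m" for n m
    proof -
      have "\<pi> (u n - u m) \<le> \<pi> (u n - u N) + \<pi> (u m - u N)"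
        using pi_add[of "u n - u N" "u N - u m"] pi_minus_commute[of "u N" "u m"] by simp
      moreover have "\<pi> (u n - u N) \<le> c / (1 - q) * q ^ N" "\<pi> (u m - u N) \<le> c / (1 - q) * q ^ N"
        using diff[of N "n - N"] diff[of N "m - N"] that by simp_all
      ultimately show ?thesis using N by linarith
    qed
    then show "\<exists>N. \<forall>n n'. N \<le> n \<longrightarrow> N \<le> n' \<longrightarrow> \<pi> (u n - u n') < e" by blast
  qed simp
  then obtain w where w: "limitin (Metric_space.mtopology UNIV (\<lambda>x y. \<pi> (x - y))) u w sequentially"
    using pi_mcomplete unfolding Metric_space.mcomplete_def[OF pi_metric] by blast
  have "(\<lambda>n. \<pi> (u n - w)) \<longlonglongrightarrow> 0"
  proof (rule tendstoI)
    fix e :: real assume "e > 0"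
    then have "eventually (\<lambda>n. \<pi> (u n - w) < e) sequentially"
      using w by (simp add: Metric_space.limitin_metric[OF pi_metric])
    then show "eventually (\<lambda>n. dist (\<pi> (u n - w)) 0 < e) sequentially"
      by eventually_elim (simp add: pi_nonneg dist_real_def)
  qed
  then have lim: "(\<lambda>n. \<phi> (u n)) \<longlonglongrightarrow> \<phi> w" if \<phi>: "\<phi> \<in> top_dual" for \<phi>
  proof -
    have "(\<lambda>n. dual_norm \<pi> \<phi> * \<pi> (u n - w)) \<longlonglongrightarrow> 0"
      using \<open>(\<lambda>n. \<pi> (u n - w)) \<longlonglongrightarrow> 0\<close> by (rule tendsto_mult_right_zero)
    then have "(\<lambda>n. \<phi> (u n - w)) \<longlonglongrightarrow> 0"
      by (rule Lim_null_comparison[rotated]) (simp add: top_dual_bound[OF \<phi>])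
    then show ?thesis by (simp add: linear_diff[OF top_dualD(1)[OF \<phi>]] LIM_zero_iff)
  qed
  have eq: "\<phi> (T h w) - \<phi> w = - integral {0..h} (\<lambda>t. \<phi> (T t y))"
    if h: "0 < h" and \<phi>: "\<phi> \<in> top_dual" for h \<phi>
  proof -
    let ?I = "\<lambda>a b. integral {a..b} (\<lambda>t. \<phi> (T t y))"
    have \<psi>: "\<phi> \<circ> T h \<in> top_dual" using adjoint_top_dual[OF \<phi>] h by simp
    \<comment> \<open>Applying \<open>T h\<close> moves the window of integration from
      \<open>{0..n}\<close> to \<open>{h..n + h}\<close>; the two differ by the vanishing piece at
      the right and the fixed piece \<open>{0..h}\<close>.\<close>
    have "(\<phi> \<circ> T h) (u n) - \<phi> (u n) = ?I (real n) (real n + h) - ?I 0 h" for n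
    proof -
      have "(\<phi> \<circ> T h) (u n) = ?I h (real n + h)"
        unfolding u[OF \<psi>] using orbit_integral_shift[OF \<phi>, of h 0 "real n" y] h by simp
      moreover have "?I 0 (real n + h) = ?I 0 h + ?I h (real n + h)"
        by (rule orbit_integral_combine[OF \<phi>]) (use h in auto)
      moreover have "?I 0 (real n + h) = ?I 0 (real n) + ?I (real n) (real n + h)"
        by (rule orbit_integral_combine[OF \<phi>]) (use h in auto)
      ultimately show ?thesis by (simp add: u[OF \<phi>])
    qed
    moreover have "(\<lambda>n. ?I (real n) (real n + h)) \<longlonglongrightarrow> 0"
    proof (rule Lim_null_comparison)
      show "eventually (\<lambda>n. norm (?I (real n) (real n + h)) \<le> (dual_norm \<pi> \<phi> * c * h) * q ^ n) sequentially"
        using tail[OF \<phi>, of h] h by (simp add: mult.assoc mult.commute mult.left_commute)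
    qed (rule qlim)
    then have "(\<lambda>n. ?I (real n) (real n + h) - ?I 0 h) \<longlonglongrightarrow> 0 - ?I 0 h" by (intro tendsto_intros)
    moreover have "(\<lambda>n. (\<phi> \<circ> T h) (u n) - \<phi> (u n)) \<longlonglongrightarrow> (\<phi> \<circ> T h) w - \<phi> w"
      by (intro tendsto_diff lim \<phi> \<psi>)
    ultimately have "(\<phi> \<circ> T h) w - \<phi> w = 0 - ?I 0 h" by (metis (no_types, lifting) LIMSEQ_unique ext)
    then show ?thesis by simp
  qed
  have u0: "u 0 = 0"
    by (rule top_dual_separates) (simp add: u linear_0[OF top_dualD(1)])
  have bound: "\<pi> w \<le> c / (1 - q)"
  proof (rule pi_le)
    fix \<phi> assume \<phi>: "\<phi> \<in> top_dual" "dual_norm \<pi> \<phi> \<le> 1"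
    have "\<bar>\<phi> (u n)\<bar> \<le> c / (1 - q)" for n
      using unit_functional_le[OF \<phi>, of "u n"] diff[of 0 n] u0 by simp
    then show "\<bar>\<phi> w\<bar> \<le> c / (1 - q)"
      using tendsto_rabs[OF lim[OF \<phi>(1)]] by (intro LIMSEQ_le_const2) auto
  qed
  show ?thesis
  proof (rule that)
    show "w \<in> gen_domain T" "generator T w = - y" using gen_domainI_weak[OF eq] by auto
    show "\<pi> w \<le> M / (1 - exp (- \<epsilon>)) * \<pi> y" using bound by (simp add: c_def q_def)
    show "\<forall>\<phi>\<in>top_dual. (\<forall>t\<ge>0. 0 \<le> \<phi> (T t y)) \<longrightarrow> 0 \<le> \<phi> w"
    proof (intro ballI impI)
      fix \<phi> :: "'a \<Rightarrow> real" assume \<phi>: "\<phi> \<in> top_dual" and nonneg: "\<forall>t\<ge>0. 0 \<le> \<phi> (T t y)"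
      have "0 \<le> \<phi> (u n)" for n
        unfolding u[OF \<phi>] by (rule integral_nonneg) (use orbit_integrable[OF \<phi>] nonneg in auto)
      then show "0 \<le> \<phi> w" by (intro LIMSEQ_le_const[OF lim[OF \<phi>]]) blast
    qed
  qed
qed

text \<open>Uniform boundedness of the sums \<open>\<Sum>n<N. T n (x n)\<close> with \<open>\<pi> (x n) \<le> 1\<close>, applied to
  multiples of \<open>x n = T (N - 1 - n) x\<close>, gives \<open>\<pi> (T (N - 1) x) = O(1/N)\<close>.\<close>

lemma summable_adjoint_imp_exp_stable:
  assumes local: "C \<ge> 0" "\<And>t x. 0 \<le> t \<Longrightarrow> t \<le> 1 \<Longrightarrow> \<pi> (T t x) \<le> C * \<pi> x"
    and summ: "\<And>\<phi>. \<phi> \<in> top_dual \<Longrightarrow> \<exists>K. \<forall>N. (\<Sum>n<N. dual_norm \<pi> (\<phi> \<circ> T (real n))) \<le> K"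
  shows "exp_pi_stable \<pi> T"
proof -
  define B where "B = {(\<Sum>n<N. T (real n) (x n)) | N x. \<forall>n. \<pi> (x n) \<le> 1}"
  have "\<exists>K. \<forall>x\<in>B. \<bar>\<phi> x\<bar> \<le> K" if \<phi>: "\<phi> \<in> top_dual" for \<phi>
  proof -
    obtain K where K: "\<And>N. (\<Sum>n<N. dual_norm \<pi> (\<phi> \<circ> T (real n))) \<le> K" using summ[OF \<phi>] by blast
    have "\<bar>\<phi> (\<Sum>n<N. T (real n) (x n))\<bar> \<le> K" if x: "\<forall>n. \<pi> (x n) \<le> 1" for N x
    proof -
      have "\<bar>\<phi> (\<Sum>n<N. T (real n) (x n))\<bar> \<le> (\<Sum>n<N. \<bar>\<phi> (T (real n) (x n))\<bar>)"
        by (simp add: linear_sum[OF top_dualD(1)[OF \<phi>]])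
      also have "\<dots> \<le> (\<Sum>n<N. dual_norm \<pi> (\<phi> \<circ> T (real n)))"
      proof (rule sum_mono)
        fix n
        have "dual_norm \<pi> (\<phi> \<circ> T (real n)) * \<pi> (x n) \<le> dual_norm \<pi> (\<phi> \<circ> T (real n)) * 1"
          using x top_dual_norm_nonneg[OF adjoint_top_dual[OF \<phi>]] by (intro mult_left_mono) auto
        then show "\<bar>\<phi> (T (real n) (x n))\<bar> \<le> dual_norm \<pi> (\<phi> \<circ> T (real n))"
          using adjoint_bound[OF \<phi>, of "real n" "x n"] by simp
      qed
      finally show ?thesis using K order_trans by blast
    qed
    then show ?thesis by (auto simp: B_def)
  qed
  from weakly_bounded_imp_pi_bounded[OF this] obtain K0 where K0: "\<And>x. x \<in> B \<Longrightarrow> \<pi> x \<le> K0" by blast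
  \<comment> \<open>The lower bound 1 permits division by \<open>K\<close>.\<close>
  define K where "K = max K0 1"
  have K: "K \<ge> 1" "\<And>x. x \<in> B \<Longrightarrow> \<pi> x \<le> K" using K0 by (auto simp: K_def max_def intro: order_trans)
  have single: "\<pi> (T (real n) x) \<le> K * \<pi> x" for n x
  proof (rule pi_le_scale[OF T_linear])
    fix x assume x: "\<pi> x \<le> 1"
    define y where "y = (\<lambda>k. if k = n then x else 0)"
    have "\<forall>k. \<pi> (y k) \<le> 1" using x by (simp add: y_def)
    then have "(\<Sum>k<Suc n. T (real k) (y k)) \<in> B" unfolding B_def by blast
    moreover have "(\<Sum>k<Suc n. T (real k) (y k)) = T (real n) x"
      by (simp add: y_def linear_0[OF T_linear])
    ultimately show "\<pi> (T (real n) x) \<le> K" using K(2) by simp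
  qed simp
  have decay: "real (Suc n) * \<pi> (T (real n) x) \<le> K\<^sup>2 * \<pi> x" for n x
  proof -
    have lin: "linear (\<lambda>x. real (Suc n) *\<^sub>R T (real n) x)"
      using T_linear[of "real n"] by (auto simp: linear_iff scaleR_add_right)
    have "\<pi> (real (Suc n) *\<^sub>R T (real n) x) \<le> K\<^sup>2 * \<pi> x"
    proof (rule pi_le_scale[OF lin])
      fix x assume x: "\<pi> x \<le> 1"
      \<comment> \<open>The factor \<open>1 / K\<close> puts every \<open>y k\<close> in the unit
        ball by \<open>single\<close>; removing it costs a second factor, hence
        \<open>K\<^sup>2\<close>.\<close>
      define y where "y = (\<lambda>k. (1 / K) *\<^sub>R T (real (n - k)) x)"
      have "\<pi> (y k) \<le> 1" for k
      proof -
        have "K * \<pi> x \<le> K * 1" using x K(1) by (intro mult_left_mono) auto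
        then have "\<pi> (T (real (n - k)) x) \<le> K" using single[of "n - k" x] by simp
        then show ?thesis using K(1) by (simp add: y_def pi_scale field_simps)
      qed
      then have mem: "(\<Sum>k<Suc n. T (real k) (y k)) \<in> B" unfolding B_def by blast
      have "T (real k) (y k) = (1 / K) *\<^sub>R T (real n) x" if "k < Suc n" for k
      proof -
        have "real k + real (n - k) = real n" using that by simp
        moreover have "T (real k + real (n - k)) x = T (real k) (T (real (n - k)) x)" by (rule T_add) auto
        ultimately have "T (real n) x = T (real k) (T (real (n - k)) x)" by (simp only:)
        then show ?thesis by (simp only: y_def linear_scale[OF T_linear[OF of_nat_0_le_iff]])
      qed
      then have "(\<Sum>k<Suc n. T (real k) (y k)) = (\<Sum>k<Suc n. (1 / K) *\<^sub>R T (real n) x)"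
        by (intro sum.cong) auto
      also have "\<dots> = (real (Suc n) / K) *\<^sub>R T (real n) x"
        by (simp only: sum_constant_scaleR card_lessThan) simp
      finally have "\<pi> ((real (Suc n) / K) *\<^sub>R T (real n) x) \<le> K" using K(2)[OF mem] by (simp only:)
      then show "\<pi> (real (Suc n) *\<^sub>R T (real n) x) \<le> K\<^sup>2"
        using K(1) by (simp add: pi_scale pos_divide_le_eq power2_eq_square del: of_nat_Suc)
    qed
    then show ?thesis by (simp add: pi_scale del: of_nat_Suc)
  qed
  \<comment> \<open>From here on \<open>K\<^sup>2 / (m + 1)\<close> is at most 1/2, so time
    \<open>m\<close> halves the norm.\<close>
  obtain m :: nat where m: "real m \<ge> 2 * K\<^sup>2" "m > 0"
  proof -
    obtain m :: nat where "real m \<ge> 2 * K\<^sup>2" using real_arch_simple by blast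
    then show ?thesis by (intro that[of "Suc m"]) auto
  qed
  have half: "\<pi> (T (real m) x) \<le> 1/2 * \<pi> x" for x
  proof -
    have "2 * K\<^sup>2 * \<pi> (T (real m) x) \<le> real (Suc m) * \<pi> (T (real m) x)"
      using m pi_nonneg by (intro mult_right_mono) auto
    then have "K\<^sup>2 * (2 * \<pi> (T (real m) x)) \<le> K\<^sup>2 * \<pi> x" using decay[of m x] by simp
    moreover have "K\<^sup>2 > 0" using K(1) by simp
    ultimately have "2 * \<pi> (T (real m) x) \<le> \<pi> x" by (rule mult_left_le_imp_le)
    then show ?thesis by simp
  qed
  have halves: "\<pi> (T (real (k * m)) x) \<le> (1/2) ^ k * \<pi> x" for k x
  proof (induction k)
    case (Suc k)
    have "T (real (Suc k * m)) x = T (real m) (T (real (k * m)) x)"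
      using T_add[of "real m" "real (k * m)" x] by simp
    then show ?case using half[of "T (real (k * m)) x"] Suc by simp
  qed simp
  define \<epsilon> where "\<epsilon> = ln 2 / real m"
  have \<epsilon>: "\<epsilon> > 0" using m by (simp add: \<epsilon>_def)
  have "\<pi> (T t x) \<le> (2 * K * (C + 1)) * exp (- \<epsilon> * t) * \<pi> x" if t: "t \<ge> 0" for t x
  proof -
    \<comment> \<open>Time splits as \<open>t = k * m + r + s\<close>: the first part yields
      \<open>k\<close> halvings, the integer \<open>r < m\<close> costs \<open>K\<close>, and
      \<open>s\<close> in the unit interval costs \<open>C\<close>. The factor 2 repays the
      incomplete last block, and \<open>C + 1\<close> keeps the constant positive.\<close>
    define j where "j = nat \<lfloor>t\<rfloor>"
    define s where "s = t - real j"
    have s: "0 \<le> s" "s \<le> 1" "t = real j + s" using t by (auto simp: j_def s_def) linarith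
    define k r where "k = j div m" and "r = j mod m"
    have j: "real j = real (k * m) + real r"
      unfolding of_nat_add[symmetric] by (simp add: k_def r_def)
    have "t < real (Suc k) * real m"
    proof -
      have "r < m" using m(2) by (simp add: r_def)
      then have "real r + 1 \<le> real m" by linarith
      moreover have "t < real j + 1" using t by (simp add: j_def)
      ultimately show ?thesis using j by (simp add: algebra_simps)
    qed
    then have "\<epsilon> * t \<le> \<epsilon> * (real (Suc k) * real m)" using \<epsilon> by (intro mult_left_mono) auto
    also have "\<dots> = real (Suc k) * ln 2" using m by (simp add: \<epsilon>_def)
    finally have "exp (- (real (Suc k) * ln 2)) \<le> exp (- \<epsilon> * t)" by simp
    moreover have "exp (- (real (Suc k) * ln 2)) = (1/2) ^ Suc k"
      by (simp add: exp_minus exp_of_nat_mult power_one_over inverse_eq_divide del: of_nat_Suc)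
    ultimately have "(1/2) ^ Suc k \<le> exp (- \<epsilon> * t)" by (simp only:)
    then have pow: "(1/2) ^ k \<le> 2 * exp (- \<epsilon> * t)" by simp
    have "T t x = T (real (k * m)) (T (real r) (T s x))"
      using T_add[of "real (k * m)" "real r + s" x] T_add[of "real r" s x] s j by (simp add: add.assoc)
    then have "\<pi> (T t x) \<le> (1/2) ^ k * \<pi> (T (real r) (T s x))" using halves by simp
    also have "\<dots> \<le> (1/2) ^ k * (K * (C * \<pi> x))"
    proof (intro mult_left_mono)
      have "\<pi> (T (real r) (T s x)) \<le> K * \<pi> (T s x)" by (rule single)
      also have "\<dots> \<le> K * (C * \<pi> x)" using local(2)[OF s(1,2)] K(1) by (intro mult_left_mono) auto
      finally show "\<pi> (T (real r) (T s x)) \<le> K * (C * \<pi> x)" .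
    qed simp
    also have "\<dots> \<le> (2 * exp (- \<epsilon> * t)) * (K * ((C + 1) * \<pi> x))"
      using pow K(1) local(1) pi_nonneg[of x] by (intro mult_mono) auto
    finally show ?thesis by (simp only: mult_ac)
  qed
  moreover have "2 * K * (C + 1) > 0" using K(1) local(1) by (auto intro!: mult_pos_pos)
  ultimately show ?thesis unfolding exp_pi_stable_def using \<epsilon> by blast
qed

end

section \<open>Positive semigroups and the implications between the conditions\<close>

locale positive_semigroup_pair = Cb_semigroup_pair \<pi> T
  for \<pi> :: "'a::locally_convex_space \<Rightarrow> real" and T +
  fixes P :: "'a set"
  assumes cone: "closed_proper_cone P" and positive: "positive_semigroup P T"
    and compatible: "pi_compatible \<pi> P T" and generating: "dual_cone_generating P"
begin

lemma T_mem_cone: "x \<in> P \<Longrightarrow> 0 \<le> t \<Longrightarrow> T t x \<in> P"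
  using positive by (auto simp: positive_semigroup_def positive_op_def)

lemma dual_coneD: "\<phi> \<in> dual_cone P \<Longrightarrow> \<phi> \<in> top_dual" "\<phi> \<in> dual_cone P \<Longrightarrow> x \<in> P \<Longrightarrow> 0 \<le> \<phi> x"
  by (auto simp: dual_cone_def)

lemma top_dual_decompose:
  assumes "\<phi> \<in> top_dual"
  obtains \<phi>1 \<phi>2 where "\<phi>1 \<in> dual_cone P" "\<phi>2 \<in> dual_cone P" "\<phi> = (\<lambda>x. \<phi>1 x - \<phi>2 x)"
  using assms generating unfolding dual_cone_generating_def by blast

text \<open>For a positive functional the adjoint norms are continuous, hence bounded on the unit
  interval. Differences of positive functionals exhaust the dual, so the images of the unit ball are
  weakly bounded and therefore bounded for \<open>\<pi>\<close>.\<close>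

lemma local_bound:
  obtains C where "C \<ge> 0" "\<And>t x. 0 \<le> t \<Longrightarrow> t \<le> 1 \<Longrightarrow> \<pi> (T t x) \<le> C * \<pi> x"
proof -
  define B where "B = {T t x | t x. 0 \<le> t \<and> t \<le> 1 \<and> \<pi> x \<le> 1}"
  have pos: "\<exists>c. \<forall>x\<in>B. \<bar>\<phi> x\<bar> \<le> c" if \<phi>: "\<phi> \<in> dual_cone P" for \<phi>
  proof -
    have "continuous_on {0..1} (\<lambda>t. dual_norm \<pi> (\<phi> \<circ> T t))"
      by (rule continuous_on_subset[of "{0..}"]) (use compatible \<phi> in \<open>auto simp: pi_compatible_def\<close>)
    then have "compact ((\<lambda>t. dual_norm \<pi> (\<phi> \<circ> T t)) ` {0..1})"
      by (rule compact_continuous_image) simp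
    then obtain c where c: "\<And>t. 0 \<le> t \<Longrightarrow> t \<le> 1 \<Longrightarrow> dual_norm \<pi> (\<phi> \<circ> T t) \<le> c"
      using bounded_imp_bdd_above[OF compact_imp_bounded] unfolding bdd_above_def by force
    have "\<bar>\<phi> (T t x)\<bar> \<le> c" if t: "0 \<le> t" "t \<le> 1" and x: "\<pi> x \<le> 1" for t x
    proof -
      have "dual_norm \<pi> (\<phi> \<circ> T t) * \<pi> x \<le> dual_norm \<pi> (\<phi> \<circ> T t) * 1"
        using x top_dual_norm_nonneg[OF adjoint_top_dual[OF dual_coneD(1)[OF \<phi>] t(1)]]
        by (intro mult_left_mono) auto
      then show ?thesis using adjoint_bound[OF dual_coneD(1)[OF \<phi>] t(1), of x] c[OF t] by simp
    qed
    then show ?thesis by (auto simp: B_def)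
  qed
  have "\<exists>c. \<forall>x\<in>B. \<bar>\<phi> x\<bar> \<le> c" if dual: "\<phi> \<in> top_dual" for \<phi>
  proof -
    obtain \<phi>1 \<phi>2 where \<phi>: "\<phi>1 \<in> dual_cone P" "\<phi>2 \<in> dual_cone P" "\<phi> = (\<lambda>x. \<phi>1 x - \<phi>2 x)"
      using top_dual_decompose[OF dual] by blast
    obtain c1 c2 where "\<forall>x\<in>B. \<bar>\<phi>1 x\<bar> \<le> c1" "\<forall>x\<in>B. \<bar>\<phi>2 x\<bar> \<le> c2" using pos \<phi> by blast
    then have "\<bar>\<phi> x\<bar> \<le> c1 + c2" if "x \<in> B" for x using that \<phi>(3) by fastforce
    then show ?thesis by blast
  qed
  from weakly_bounded_imp_pi_bounded[OF this] obtain C0 where C0: "\<And>x. x \<in> B \<Longrightarrow> \<pi> x \<le> C0" by blast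
  have "\<pi> (T t x) \<le> max C0 0 * \<pi> x" if t: "0 \<le> t" "t \<le> 1" for t x
    by (rule pi_le_scale[OF T_linear[OF t(1)]])
      (use C0 t in \<open>auto simp: B_def le_max_iff_disj\<close>)
  then show ?thesis using that[of "max C0 0"] by simp
qed

lemma L1_stable_imp_exp_stable:
  assumes "L1_pi_stable \<pi> P T"
  shows "exp_pi_stable \<pi> T"
proof -
  obtain C where C: "C \<ge> 0" "\<And>t x. 0 \<le> t \<Longrightarrow> t \<le> 1 \<Longrightarrow> \<pi> (T t x) \<le> C * \<pi> x"
    using local_bound by blast
  let ?u = "\<lambda>\<phi> n. dual_norm \<pi> (\<phi> \<circ> T (real n))"
  have nonneg: "0 \<le> ?u \<phi> n" if "\<phi> \<in> top_dual" for \<phi> n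
    using top_dual_norm_nonneg[OF adjoint_top_dual[OF that]] by simp
  have pos: "\<exists>K. \<forall>N. (\<Sum>n<N. ?u \<phi> n) \<le> K" if \<phi>: "\<phi> \<in> dual_cone P" for \<phi>
  proof -
    note \<phi>' = dual_coneD(1)[OF \<phi>]
    let ?g = "\<lambda>t. dual_norm \<pi> (\<phi> \<circ> T t)"
    \<comment> \<open>On a unit interval the adjoint norm at the right end point is controlled by
      that at every earlier time, since \<open>T (Suc n)\<close> factors through \<open>T t\<close>
      with a remaining time of at most 1. Using \<open>C + 1\<close> makes the divisor
      positive.\<close>
    have le: "?u \<phi> (Suc n) / (C + 1) \<le> ?g t" if t: "real n \<le> t" "t < real n + 1" for n t
    proof -
      have t0: "t \<ge> 0" using t by simp
      have g0: "?g t \<ge> 0" by (rule top_dual_norm_nonneg[OF adjoint_top_dual[OF \<phi>' t0]])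
      have "?u \<phi> (Suc n) \<le> ?g t * (C + 1)"
      proof (rule dual_norm_le)
        fix x
        have "T (real (Suc n)) x = T t (T (real (Suc n) - t) x)"
          using T_add[OF t0, of "real (Suc n) - t" x] t by simp
        then have "\<bar>(\<phi> \<circ> T (real (Suc n))) x\<bar> \<le> ?g t * \<pi> (T (real (Suc n) - t) x)"
          using adjoint_bound[OF \<phi>' t0] by simp
        also have "\<dots> \<le> ?g t * ((C + 1) * \<pi> x)"
        proof (rule mult_left_mono[OF _ g0])
          have "\<pi> (T (real (Suc n) - t) x) \<le> C * \<pi> x" using t by (intro C(2)) auto
          also have "\<dots> \<le> (C + 1) * \<pi> x" using pi_nonneg by (intro mult_right_mono) auto
          finally show "\<pi> (T (real (Suc n) - t) x) \<le> (C + 1) * \<pi> x" .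
        qed
        finally show "\<bar>(\<phi> \<circ> T (real (Suc n))) x\<bar> \<le> ?g t * (C + 1) * \<pi> x" by (simp add: mult.assoc)
      qed (use g0 C(1) in simp)
      then show ?thesis using C(1) by (simp add: field_simps)
    qed
    have "(\<integral>\<^sup>+t\<in>{0..}. ennreal (?g t) \<partial>lborel) < \<infinity>"
      using assms \<phi> by (auto simp: L1_pi_stable_def L1_norm_finite_def)
    then obtain I where I: "(\<integral>\<^sup>+t\<in>{0..}. ennreal (?g t) \<partial>lborel) = ennreal I" "0 \<le> I"
      by (cases "\<integral>\<^sup>+t\<in>{0..}. ennreal (?g t) \<partial>lborel") auto
    have "(\<Sum>n<N. ?u \<phi> (Suc n) / (C + 1)) \<le> I" for N
    proof -
      have "ennreal (\<Sum>n<N. ?u \<phi> (Suc n) / (C + 1)) \<le> ennreal I"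
        unfolding I(1)[symmetric]
        by (rule sum_le_nn_integral_atLeast[OF le])
          (use C(1) in \<open>auto intro!: divide_nonneg_nonneg nonneg[OF \<phi>'] simp del: of_nat_Suc\<close>)
      then show ?thesis using I(2) by simp
    qed
    then have shifted: "(\<Sum>n<N. ?u \<phi> (Suc n)) \<le> I * (C + 1)" for N
      using C(1) by (simp add: sum_divide_distrib[symmetric] pos_divide_le_eq)
    \<comment> \<open>The comparison with right end points leaves out time 0, whose term is added by
      hand.\<close>
    have "(\<Sum>n<N. ?u \<phi> n) \<le> ?u \<phi> 0 + I * (C + 1)" for N
    proof -
      have "(\<Sum>n<N. ?u \<phi> n) \<le> (\<Sum>n<Suc N. ?u \<phi> n)" using nonneg[OF \<phi>'] by simp
      also have "\<dots> = ?u \<phi> 0 + (\<Sum>n<N. ?u \<phi> (Suc n))" by (rule sum.lessThan_Suc_shift)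
      finally show ?thesis using shifted[of N] by simp
    qed
    then show ?thesis by blast
  qed
  have summ: "\<exists>K. \<forall>N. (\<Sum>n<N. ?u \<phi> n) \<le> K" if \<phi>: "\<phi> \<in> top_dual" for \<phi>
  proof -
    obtain \<phi>1 \<phi>2 where d: "\<phi>1 \<in> dual_cone P" "\<phi>2 \<in> dual_cone P" "\<phi> = (\<lambda>x. \<phi>1 x - \<phi>2 x)"
      using top_dual_decompose[OF \<phi>] by blast
    note d' = d(1,2)[THEN dual_coneD(1)]
    obtain K1 K2 where K: "\<And>N. (\<Sum>n<N. ?u \<phi>1 n) \<le> K1" "\<And>N. (\<Sum>n<N. ?u \<phi>2 n) \<le> K2"
      using pos d by metis
    have "?u \<phi> n \<le> ?u \<phi>1 n + ?u \<phi>2 n" for n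
    proof (rule dual_norm_le)
      show "0 \<le> ?u \<phi>1 n + ?u \<phi>2 n" using nonneg d' by simp
      show "\<bar>(\<phi> \<circ> T (real n)) x\<bar> \<le> (?u \<phi>1 n + ?u \<phi>2 n) * \<pi> x" for x
        using adjoint_bound[OF d'(1), of "real n" x] adjoint_bound[OF d'(2), of "real n" x]
        by (simp add: d(3) distrib_right)
    qed
    then have "(\<Sum>n<N. ?u \<phi> n) \<le> (\<Sum>n<N. ?u \<phi>1 n) + (\<Sum>n<N. ?u \<phi>2 n)" for N
      unfolding sum.distrib[symmetric] by (rule sum_mono)
    then have "(\<Sum>n<N. ?u \<phi> n) \<le> K1 + K2" for N using K[of N] by (meson add_mono order_trans)
    then show ?thesis by blast
  qed
  show ?thesis by (rule summable_adjoint_imp_exp_stable[OF C summ])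
qed

lemma solution_imp_L1_stable:
  assumes x: "x \<in> gen_domain T \<inter> P" "generator T x = - z"
    and F: "L1_pi_stability_subset \<pi> P \<C> F" "T \<in> \<C>" and z: "L1_pi_detector \<pi> P T F z"
  shows "L1_pi_stable \<pi> P T"
proof -
  have "L1_norm_finite \<pi> T \<phi>" if "\<phi> \<in> F" for \<phi>
  proof -
    have \<phi>: "\<phi> \<in> dual_cone P" using F(1) that by (auto simp: L1_pi_stability_subset_def)
    note \<phi>' = dual_coneD(1)[OF \<phi>]
    have zP: "z \<in> P" using z by (simp add: L1_pi_detector_def)
    have "(\<integral>\<^sup>+t\<in>{0..}. ennreal (\<phi> (T t z)) \<partial>lborel) \<le> ennreal (\<phi> x)"
    proof (rule nn_integral_atLeast_le)
      show "continuous_on {0..} (\<lambda>t. \<phi> (T t z))" by (rule orbit_cont[OF \<phi>']) simp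
      show "0 \<le> \<phi> (T t z)" if "0 \<le> t" for t by (rule dual_coneD(2)[OF \<phi> T_mem_cone[OF zP that]])
      fix n :: nat
      have "\<phi> (T (real n) x) - \<phi> x = integral {0..real n} (\<lambda>t. \<phi> (T t (- z)))"
        using generator_orbit[OF _ \<phi>', of x "real n"] x by simp
      also have "\<dots> = integral {0..real n} (\<lambda>t. - \<phi> (T t z))"
        by (intro integral_cong) (simp add: linear_neg[OF T_linear] linear_neg[OF top_dualD(1)[OF \<phi>']])
      finally have "\<phi> (T (real n) x) - \<phi> x = - integral {0..real n} (\<lambda>t. \<phi> (T t z))" by simp
      moreover have "0 \<le> \<phi> (T (real n) x)" using x(1) by (intro dual_coneD(2)[OF \<phi>] T_mem_cone) auto
      ultimately show "integral {0..real n} (\<lambda>t. \<phi> (T t z)) \<le> \<phi> x" by linarith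
    qed
    also have "\<dots> < \<infinity>" by simp
    finally show ?thesis using z that by (auto simp: L1_pi_detector_def)
  qed
  then show ?thesis using F by (auto simp: L1_pi_stability_subset_def)
qed

lemma exp_stable_imp_inverse:
  assumes "exp_pi_stable \<pi> T"
  shows "bij_betw (generator T) (gen_domain T) UNIV \<and>
    pi_bounded_op \<pi> (inv_into (gen_domain T) (generator T)) \<and>
    positive_op P (\<lambda>y. - inv_into (gen_domain T) (generator T) y)"
proof -
  let ?D = "gen_domain T" and ?A = "generator T"
  let ?G = "inv_into ?D ?A"
  obtain M \<epsilon> where \<epsilon>: "\<epsilon> > 0" and stable: "\<And>x t. 0 \<le> t \<Longrightarrow> \<pi> (T t x) \<le> M * exp (- \<epsilon> * t) * \<pi> x"
    using assms by (auto simp: exp_pi_stable_def)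
  have inj: "inj_on ?A ?D"
    by (rule inj_onI) (rule exp_stable_generator_inj[OF stable \<epsilon>])
  define K where "K = M / (1 - exp (- \<epsilon>))"
  have "\<exists>w. w \<in> ?D \<and> ?A w = - y \<and> \<pi> w \<le> K * \<pi> y \<and> (y \<in> P \<longrightarrow> w \<in> P)" for y
  proof -
    obtain w where w: "w \<in> ?D" "?A w = - y" "\<pi> w \<le> M / (1 - exp (- \<epsilon>)) * \<pi> y"
      "\<forall>\<phi>\<in>top_dual. (\<forall>t\<ge>0. 0 \<le> \<phi> (T t y)) \<longrightarrow> 0 \<le> \<phi> w"
      by (rule exp_stable_solve[OF stable \<epsilon>, of y]) (assumption, rule that)
    have "w \<in> P" if y: "y \<in> P"
    proof (rule mem_closed_convex_cone)
      show "closed P" "convex_cone P" using cone by (auto simp: closed_proper_cone_def)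
      show "0 \<le> \<phi> w" if \<phi>: "\<phi> \<in> dual_cone P" for \<phi>
        using w(4) dual_coneD(1)[OF \<phi>] dual_coneD(2)[OF \<phi> T_mem_cone[OF y]] by blast
    qed
    then show ?thesis using w(1-3) unfolding K_def by blast
  qed
  \<comment> \<open>\<open>R\<close> is a choice of solutions with the sign of \<open>- A\<close>
    inverted. Injectivity identifies it with \<open>- ?G\<close>; linearity is then taken from the
    generator, not from the choice.\<close>
  then obtain R where R: "\<And>y. R y \<in> ?D" "\<And>y. ?A (R y) = - y" "\<And>y. \<pi> (R y) \<le> K * \<pi> y"
    "\<And>y. y \<in> P \<Longrightarrow> R y \<in> P" by metis
  have "?A ` ?D = UNIV"
  proof -
    have "y \<in> ?A ` ?D" for y using R(1)[of "- y"] R(2)[of "- y"] by (metis imageI minus_minus)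
    then show ?thesis by blast
  qed
  then have bij: "bij_betw ?A ?D UNIV" using inj by (simp add: bij_betw_def)
  have G: "?G (?A w) = w" if "w \<in> ?D" for w using inv_into_f_f[OF inj that] .
  have G_R: "?G y = R (- y)" for y using G[OF R(1)[of "- y"]] R(2)[of "- y"] by simp
  have G_dom: "?G y \<in> ?D" "?A (?G y) = y" for y using R(1,2)[of "- y"] by (simp_all add: G_R)
  have lin: "linear ?G"
  proof (rule linearI)
    show "?G (x + y) = ?G x + ?G y" for x y
      using G[OF generator_add(1)[OF G_dom(1)[of x] G_dom(1)[of y]]]
      by (simp add: generator_add(2)[OF G_dom(1) G_dom(1)] G_dom(2))
    show "?G (c *\<^sub>R y) = c *\<^sub>R ?G y" for c y
      using G[OF generator_scale(1)[OF G_dom(1)[of y], of c]]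
      by (simp add: generator_scale(2)[OF G_dom(1)] G_dom(2))
  qed
  moreover have "\<pi> (?G y) \<le> K * \<pi> y" for y using R(3)[of "- y"] by (simp add: G_R)
  moreover have "- ?G y = R y" for y using linear_neg[OF lin, of y] G_R[of "- y"] by simp
  ultimately show ?thesis
    using bij R(4) by (auto simp: pi_bounded_op_def positive_op_def)
qed

end

theorem theorem3:
  fixes \<pi> :: "'a::locally_convex_space \<Rightarrow> real"
    and P :: "'a set"
    and T :: "real \<Rightarrow> 'a \<Rightarrow> 'a"
    and \<C> :: "(real \<Rightarrow> 'a \<Rightarrow> 'a) set"
    and F :: "('a \<Rightarrow> real) set"
    and z :: 'a
  assumes "compact_convex_closures TYPE('a)"
    and "norming_dual_pair \<pi>"
    and "closed_proper_cone P"
    and "Cb_semigroup T" and "positive_semigroup P T" and "pi_compatible \<pi> P T"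
    and "\<And>S. S \<in> \<C> \<Longrightarrow> Cb_semigroup S"
    and "T \<in> \<C>"
    and "L1_pi_stability_subset \<pi> P \<C> F"
    and "L1_pi_detector \<pi> P T F z"
    and "dual_cone_generating P"
  shows "((\<exists>x \<in> gen_domain T \<inter> P. generator T x = - z) \<longleftrightarrow> L1_pi_stable \<pi> P T) \<and>
    (L1_pi_stable \<pi> P T \<longleftrightarrow> exp_pi_stable \<pi> T) \<and>
    (exp_pi_stable \<pi> T \<longleftrightarrow>
       bij_betw (generator T) (gen_domain T) UNIV \<and>
       pi_bounded_op \<pi> (inv_into (gen_domain T) (generator T)) \<and>
       positive_op P (\<lambda>y. - inv_into (gen_domain T) (generator T) y))"
proof -
  interpret positive_semigroup_pair \<pi> T P
    using assms by unfold_locales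
  let ?G = "inv_into (gen_domain T) (generator T)"
  \<comment> \<open>The witness is \<open>?G (- z)\<close>; linearity of the inverse rewrites it as
    \<open>- ?G z\<close>, and the detector \<open>z\<close> lies in the cone.\<close>
  have solve: "\<exists>x \<in> gen_domain T \<inter> P. generator T x = - z"
    if bij: "bij_betw (generator T) (gen_domain T) UNIV" and G: "pi_bounded_op \<pi> ?G"
      and pos: "positive_op P (\<lambda>y. - ?G y)"
  proof
    have surj: "- z \<in> generator T ` gen_domain T" using bij by (simp add: bij_betw_def)
    show "generator T (?G (- z)) = - z" by (rule f_inv_into_f[OF surj])
    have "?G (- z) = - ?G z" using G by (simp add: pi_bounded_op_def linear_neg)
    moreover have "z \<in> P" using assms(10) by (simp add: L1_pi_detector_def)
    ultimately have "?G (- z) \<in> P" using pos by (auto simp: positive_op_def)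
    then show "?G (- z) \<in> gen_domain T \<inter> P" using inv_into_into[OF surj] by blast
  qed
  show ?thesis
    using solve solution_imp_L1_stable[OF _ _ assms(9,8,10)] L1_stable_imp_exp_stable
      exp_stable_imp_inverse by blast
qed

end
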